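(* Let $\omega$ be a strict open subset of $\mathbb T$ (i.e. $\omega$ is open and $\omega\neq\mathbb T$) and let $T>0$. If $f_0\in H^2$ extends holomorphically to a disk larger than $\mathbb D$ and $f_0\in \mathcal{NC}_{H^2}(\omega,T)$, then $f_0 = 0$.
   Context: $\mathbb T$ is the complex unit circle, identified with $\mathbb R/2\pi\mathbb Z$ via $x\mapsto e^{ix}$; $\mathbb D$ is the open unit disk; a disk larger than $\mathbb D$ means $\{|z|<r\}$ for some $r>1$. Functions are complex valued; $f\in L^2(\mathbb T)$ is written $f(e^{ix})=\sum_{n\in\mathbb Z}\widehat f(n)e^{inx}$. The Riesz projector is $P_+f(e^{ix})=\sum_{n\ge 0}\widehat f(n)e^{inx}$, and $H^2=P_+L^2(\mathbb T)$; an element $f\in H^2$ is identified with the holomorphic function $f(z)=\sum_{n\ge0}\widehat f(n)z^n$ on $\mathbb D$. Let $S(t)f(e^{ix})=\sum_{n}\widehat f(n)e^{-|n|t}e^{inx}$ (the semigroup generated by $-|D|$, where $|D|f(e^{ix})=\sum_n|n|\widehat f(n)e^{inx}$). The $H^2$ control system is $(\partial_t+|D|)f(t,e^{ix})=P_+\mathbf 1_\omega u(t,e^{ix})$, $f(0,\cdot)=f_0\in H^2$, with control $u\in L^2([0,T]\times\omega)$; its solution satisfies $f(T,\cdot)=S(T)f_0+\int_0^TS(T-s)P_+(\mathbf 1_\omega u(s,\cdot))\,ds$, where $\mathbf 1_\omega u$ denotes the extension of $u$ by $0$ outside $\omega$. $\mathcal{NC}_{H^2}(\omega,T)$ is the set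 of $f_0\in H^2$ for which there is $u\in L^2([0,T]\times\omega)$ with $f(T,\cdot)=0$.
   Formalization: The condition ω ≠ T is strengthened to: ω is not dense in T (its complement contains an arc). As stated the claim fails: for ω = T minus one point, the control u = −1/T steers f₀ = 1 to 0. *)

theory Defs
  imports "HOL-Complex_Analysis.Complex_Analysis"
begin

section \<open>The Hilbert space of square integrable functions on the unit circle\<close>

definition square_integrable :: "'a measure \<Rightarrow> ('a \<Rightarrow> complex) \<Rightarrow> bool" where
  "square_integrable M f \<longleftrightarrow> f \<in> borel_measurable M \<and> integrable M (\<lambda>x. (cmod (f x))\<^sup>2)"

text \<open>Normalised arc length, carried by the unit circle.  What a function does off the circle
  is irrelevant, the complement of the circle being a null set.  The point \<open>x\<close> of
  \<open>\<real> / 2\<pi>\<int>\<close> is represented by \<open>cis x\<close>, so \<open>e\<^sup>i\<^sup>n\<^sup>x\<close> is \<open>z powi n\<close>.\<close>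

definition circle_measure :: "complex measure" where
  "circle_measure = distr (uniform_measure lborel {0..2*pi}) borel cis"

lemma sets_circle_measure [simp, measurable_cong]: "sets circle_measure = sets borel"
  by (simp add: circle_measure_def)

lemma space_circle_measure [simp]: "space circle_measure = UNIV"
  by (simp add: circle_measure_def)

lemma cis_borel [measurable]: "cis \<in> borel_measurable borel"
  by (intro borel_measurable_continuous_onI continuous_on_cis continuous_on_id)

lemma emeasure_circle_measure_UNIV [simp]: "emeasure circle_measure UNIV = 1"
proof -
  have "emeasure circle_measure UNIV = emeasure (uniform_measure lborel {0..2*pi}) UNIV"
    unfolding circle_measure_def by (subst emeasure_distr) auto
  also have "\<dots> = 1"
    by (subst emeasure_uniform_measure) (auto simp: ennreal_divide_self)
  finally show ?thesis .
qed

interpretation circle: finite_measure circle_measure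
  by standard auto

lemma AE_circle_norm: "AE z in circle_measure. cmod z = 1"
  unfolding circle_measure_def by (subst AE_distr_iff) auto

lemma square_integrable_0: "square_integrable M (\<lambda>x. 0)"
  by (simp add: square_integrable_def)

lemma square_integrable_cmult:
  "square_integrable M f \<Longrightarrow> square_integrable M (\<lambda>x. c * f x)"
  by (auto simp: square_integrable_def norm_mult power_mult_distrib)

lemma square_integrable_uminus:
  "square_integrable M f \<Longrightarrow> square_integrable M (\<lambda>x. - f x)"
  by (auto simp: square_integrable_def)

lemma square_integrable_add:
  assumes "square_integrable M f" "square_integrable M g"
  shows "square_integrable M (\<lambda>x. f x + g x)"
proof -
  have [measurable]: "f \<in> borel_measurable M" "g \<in> borel_measurable M"
    using assms by (auto simp: square_integrable_def)
  have "integrable M (\<lambda>x. 2 * (cmod (f x))\<^sup>2 + 2 * (cmod (g x))\<^sup>2)"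
    using assms by (auto simp: square_integrable_def)
  then have "integrable M (\<lambda>x. (cmod (f x + g x))\<^sup>2)"
  proof (rule Bochner_Integration.integrable_bound)
    show "AE x in M. norm ((cmod (f x + g x))\<^sup>2) \<le> norm (2 * (cmod (f x))\<^sup>2 + 2 * (cmod (g x))\<^sup>2)"
    proof (rule AE_I2)
      fix x
      have "(cmod (f x + g x))\<^sup>2 \<le> (cmod (f x) + cmod (g x))\<^sup>2"
        by (intro power_mono norm_triangle_ineq) auto
      also have "\<dots> \<le> 2 * (cmod (f x))\<^sup>2 + 2 * (cmod (g x))\<^sup>2"
        using sum_squares_bound[of "cmod (f x)" "cmod (g x)"] by (simp add: power2_sum)
      finally show "norm ((cmod (f x + g x))\<^sup>2) \<le> norm (2 * (cmod (f x))\<^sup>2 + 2 * (cmod (g x))\<^sup>2)"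
        by simp
    qed
  qed measurable
  then show ?thesis by (auto simp: square_integrable_def)
qed

lemma square_integrable_diff:
  "square_integrable M f \<Longrightarrow> square_integrable M g \<Longrightarrow> square_integrable M (\<lambda>x. f x - g x)"
  using square_integrable_add[of M f "\<lambda>x. - g x"] square_integrable_uminus[of M g] by simp

lemma integrable_mult_square_integrable:
  assumes "square_integrable M f" "square_integrable M g"
  shows "integrable M (\<lambda>x. f x * g x)"
proof -
  have [measurable]: "f \<in> borel_measurable M" "g \<in> borel_measurable M"
    using assms by (auto simp: square_integrable_def)
  have "integrable M (\<lambda>x. (cmod (f x))\<^sup>2 + (cmod (g x))\<^sup>2)"
    using assms by (auto simp: square_integrable_def)
  then show ?thesis
  proof (rule Bochner_Integration.integrable_bound)
    show "AE x in M. norm (f x * g x) \<le> norm ((cmod (f x))\<^sup>2 + (cmod (g x))\<^sup>2)"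
    proof (rule AE_I2)
      fix x
      have "2 * (cmod (f x) * cmod (g x)) \<le> (cmod (f x))\<^sup>2 + (cmod (g x))\<^sup>2"
        using sum_squares_bound[of "cmod (f x)" "cmod (g x)"] by simp
      moreover have "0 \<le> cmod (f x) * cmod (g x)" by simp
      ultimately have "cmod (f x) * cmod (g x) \<le> (cmod (f x))\<^sup>2 + (cmod (g x))\<^sup>2"
        by linarith
      then show "norm (f x * g x) \<le> norm ((cmod (f x))\<^sup>2 + (cmod (g x))\<^sup>2)"
        by (simp add: norm_mult)
    qed
  qed measurable
qed

lemma cnj_borel [measurable]: "cnj \<in> borel_measurable borel"
  by (intro borel_measurable_continuous_onI continuous_intros)

lemma square_integrable_cnj: "square_integrable M f \<Longrightarrow> square_integrable M (\<lambda>x. cnj (f x))"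
  by (auto simp: square_integrable_def intro: measurable_compose[OF _ cnj_borel])

lemma square_integrable_circle_bounded:
  assumes "f \<in> borel_measurable borel" "\<And>z. cmod z = 1 \<Longrightarrow> cmod (f z) \<le> B"
  shows "square_integrable circle_measure f"
  unfolding square_integrable_def
proof
  show [measurable]: "f \<in> borel_measurable circle_measure" using assms(1) by simp
  show "integrable circle_measure (\<lambda>x. (cmod (f x))\<^sup>2)"
  proof (rule circle.integrable_const_bound[where B="B\<^sup>2"])
    show "AE x in circle_measure. norm ((cmod (f x))\<^sup>2) \<le> B\<^sup>2"
      using AE_circle_norm by eventually_elim (auto intro!: power_mono assms)
  qed measurable
qed

lemma square_integrable_powi:
  "square_integrable circle_measure (\<lambda>z. z powi n)"
proof (rule square_integrable_circle_bounded[where B=1])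
  show "(\<lambda>z::complex. z powi n) \<in> borel_measurable borel"
    by (cases n) (auto simp: power_int_def)
qed (auto simp: norm_power_int)

text \<open>Square integrable functions on the circle modulo equality almost everywhere.\<close>

quotient_type L2T = "complex \<Rightarrow> complex" / partial:
  "\<lambda>f g. square_integrable circle_measure f \<and> square_integrable circle_measure g \<and>
         (AE z in circle_measure. f z = g z)"
proof (rule part_equivpI)
  show "\<exists>f. square_integrable circle_measure f \<and> square_integrable circle_measure f \<and>
         (AE z in circle_measure. f z = f z)"
    by (rule exI[of _ "\<lambda>_. 0"]) (auto simp: square_integrable_0)
  show "symp (\<lambda>f g. square_integrable circle_measure f \<and> square_integrable circle_measure g \<and>
         (AE z in circle_measure. f z = g z))"
    by (rule sympI) (auto elim!: eventually_mono)
  show "transp (\<lambda>f g. square_integrable circle_measure f \<and> square_integrable circle_measure g \<and>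
         (AE z in circle_measure. f z = g z))"
    by (rule transpI) (auto elim: eventually_elim2)
qed

instantiation L2T :: real_vector
begin

lift_definition zero_L2T :: L2T is "\<lambda>z. 0" by (simp add: square_integrable_0)

lift_definition plus_L2T :: "L2T \<Rightarrow> L2T \<Rightarrow> L2T" is "\<lambda>f g z. f z + g z"
  by (auto intro: square_integrable_add)

lift_definition minus_L2T :: "L2T \<Rightarrow> L2T \<Rightarrow> L2T" is "\<lambda>f g z. f z - g z"
  by (auto intro: square_integrable_diff)

lift_definition uminus_L2T :: "L2T \<Rightarrow> L2T" is "\<lambda>f z. - f z"
  by (auto intro: square_integrable_uminus)

lift_definition scaleR_L2T :: "real \<Rightarrow> L2T \<Rightarrow> L2T" is "\<lambda>r f z. complex_of_real r * f z"
  by (auto intro: square_integrable_cmult)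

instance
proof
  fix a b :: real and f g h :: L2T
  show "f + g + h = f + (g + h)"
    by transfer (auto intro!: square_integrable_add simp: algebra_simps)
  show "f + g = g + f"
    by transfer (auto intro!: square_integrable_add simp: algebra_simps)
  show "0 + f = f" by transfer auto
  show "- f + f = 0" by transfer (auto simp: square_integrable_0)
  show "f - g = f + - g"
    by transfer (auto intro!: square_integrable_add square_integrable_diff square_integrable_uminus)
  show "a *\<^sub>R (f + g) = a *\<^sub>R f + a *\<^sub>R g"
    by transfer (auto intro!: square_integrable_add square_integrable_cmult simp: distrib_left)
  show "(a + b) *\<^sub>R f = a *\<^sub>R f + b *\<^sub>R f"
    by transfer (auto intro!: square_integrable_add square_integrable_cmult
      simp: distrib_right)
  show "a *\<^sub>R b *\<^sub>R f = (a * b) *\<^sub>R f"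
    by transfer (auto intro!: square_integrable_cmult simp: mult.assoc)
  show "1 *\<^sub>R f = f" by transfer auto
qed

end

instantiation L2T :: real_inner
begin

lift_definition inner_L2T :: "L2T \<Rightarrow> L2T \<Rightarrow> real"
  is "\<lambda>f g. Re (LINT z|circle_measure. f z * cnj (g z))"
proof clarsimp
  fix f f' g g'
  assume [simp]: "square_integrable circle_measure f" "square_integrable circle_measure f'"
    "square_integrable circle_measure g" "square_integrable circle_measure g'"
    and eq: "AE z in circle_measure. f z = f' z" "AE z in circle_measure. g z = g' z"
  have [measurable]: "f \<in> borel_measurable borel" "f' \<in> borel_measurable borel"
    "g \<in> borel_measurable borel" "g' \<in> borel_measurable borel"
    using \<open>square_integrable circle_measure f\<close> \<open>square_integrable circle_measure f'\<close>
      \<open>square_integrable circle_measure g\<close> \<open>square_integrable circle_measure g'\<close>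
    by (auto simp: square_integrable_def)
  have "(LINT z|circle_measure. f z * cnj (g z)) = (LINT z|circle_measure. f' z * cnj (g' z))"
    by (rule integral_cong_AE, measurable) (use eq in \<open>auto elim: eventually_elim2\<close>)
  then show "Re (LINT z|circle_measure. f z * cnj (g z)) =
      Re (LINT z|circle_measure. f' z * cnj (g' z))" by simp
qed

definition norm_L2T :: "L2T \<Rightarrow> real" where "norm_L2T f = sqrt (inner f f)"
definition dist_L2T :: "L2T \<Rightarrow> L2T \<Rightarrow> real" where "dist_L2T f g = norm (f - g)"
definition sgn_L2T :: "L2T \<Rightarrow> L2T" where "sgn_L2T f = f /\<^sub>R norm f"
definition uniformity_L2T :: "(L2T \<times> L2T) filter" where
  "uniformity_L2T = (INF e\<in>{0 <..}. principal {(x, y). dist x y < e})"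
definition open_L2T :: "L2T set \<Rightarrow> bool" where
  "open_L2T S = (\<forall>x\<in>S. \<forall>\<^sub>F (x', y) in uniformity. x' = x \<longrightarrow> y \<in> S)"

instance
proof
  fix a :: real and f g h :: L2T
  show "dist f g = norm (f - g)" by (rule dist_L2T_def)
  show "sgn f = f /\<^sub>R norm f" by (rule sgn_L2T_def)
  show "uniformity = (INF e\<in>{0 <..}. principal {(x, y :: L2T). dist x y < e})"
    by (rule uniformity_L2T_def)
  show "open S = (\<forall>x\<in>S. \<forall>\<^sub>F (x', y) in uniformity. x' = x \<longrightarrow> y \<in> S)" for S :: "L2T set"
    by (rule open_L2T_def)
  show "norm f = sqrt (inner f f)" by (rule norm_L2T_def)
  show "inner f g = inner g f"
  proof transfer
    fix f g assume "square_integrable circle_measure f \<and> square_integrable circle_measure f \<and>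
        (AE z in circle_measure. f z = f z)"
      "square_integrable circle_measure g \<and> square_integrable circle_measure g \<and>
        (AE z in circle_measure. g z = g z)"
    have "(LINT z|circle_measure. g z * cnj (f z)) = cnj (LINT z|circle_measure. f z * cnj (g z))"
      by (simp add: mult.commute flip: Bochner_Integration.integral_cnj)
    then show "Re (LINT z|circle_measure. f z * cnj (g z)) =
        Re (LINT z|circle_measure. g z * cnj (f z))" by simp
  qed
  show "inner (f + g) h = inner f h + inner g h"
    by transfer
      (auto simp: distrib_right integrable_mult_square_integrable square_integrable_cnj)
  show "inner (a *\<^sub>R f) g = a * inner f g"
    by transfer (auto simp: mult.assoc)
  show "0 \<le> inner f f"
  proof transfer
    fix f
    have "(LINT z|circle_measure. f z * cnj (f z)) = of_real (LINT z|circle_measure. (cmod (f z))\<^sup>2)"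
      unfolding complex_norm_square[symmetric] integral_complex_of_real ..
    then show "0 \<le> Re (LINT z|circle_measure. f z * cnj (f z))" by simp
  qed
  show "inner f f = 0 \<longleftrightarrow> f = 0"
  proof transfer
    fix f
    assume *: "square_integrable circle_measure f \<and> square_integrable circle_measure f \<and>
        (AE z in circle_measure. f z = f z)"
    have "(LINT z|circle_measure. f z * cnj (f z)) = of_real (LINT z|circle_measure. (cmod (f z))\<^sup>2)"
      unfolding complex_norm_square[symmetric] integral_complex_of_real ..
    then have "Re (LINT z|circle_measure. f z * cnj (f z)) =
        (LINT z|circle_measure. (cmod (f z))\<^sup>2)" by simp
    moreover have "(LINT z|circle_measure. (cmod (f z))\<^sup>2) = 0 \<longleftrightarrow>
        (AE z in circle_measure. (cmod (f z))\<^sup>2 = 0)"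
      using * by (intro integral_nonneg_eq_0_iff_AE) (auto simp: square_integrable_def)
    ultimately show "Re (LINT z|circle_measure. f z * cnj (f z)) = 0 \<longleftrightarrow>
      (square_integrable circle_measure f \<and> square_integrable circle_measure (\<lambda>z. 0) \<and>
        (AE z in circle_measure. f z = 0))"
      using * by (simp add: square_integrable_0)
  qed
qed

end

lift_definition scaleC_L2T :: "complex \<Rightarrow> L2T \<Rightarrow> L2T" is "\<lambda>c f z. c * f z"
  by (auto intro: square_integrable_cmult)

lift_definition monomial_L2T :: "int \<Rightarrow> L2T" is "\<lambda>n z. z powi n"
  by (auto intro: square_integrable_powi)

lemma abs_L2T_plus:
  "square_integrable circle_measure f \<Longrightarrow> square_integrable circle_measure g \<Longrightarrow>
   abs_L2T f + abs_L2T g = abs_L2T (\<lambda>z. f z + g z)"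
  by (rule plus_L2T.abs_eq) auto

lemma abs_L2T_minus:
  "square_integrable circle_measure f \<Longrightarrow> square_integrable circle_measure g \<Longrightarrow>
   abs_L2T f - abs_L2T g = abs_L2T (\<lambda>z. f z - g z)"
  by (rule minus_L2T.abs_eq) auto

lemma scaleC_L2T_abs:
  "square_integrable circle_measure f \<Longrightarrow> scaleC_L2T c (abs_L2T f) = abs_L2T (\<lambda>z. c * f z)"
  by (rule scaleC_L2T.abs_eq) auto

lemma abs_L2T_eqI:
  "square_integrable circle_measure f \<Longrightarrow> square_integrable circle_measure g \<Longrightarrow>
   AE z in circle_measure. f z = g z \<Longrightarrow> abs_L2T f = abs_L2T g"
  by (rule Quotient_rel_abs[OF Quotient_L2T]) auto

lemma abs_L2T_cases:
  obtains f where "square_integrable circle_measure f" "x = abs_L2T f"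
proof -
  have "\<exists>f. square_integrable circle_measure f \<and> x = abs_L2T f"
    by (induct x rule: L2T.abs_induct) auto
  then show ?thesis using that by blast
qed

lemma norm_abs_L2T:
  assumes "square_integrable circle_measure f"
  shows "(norm (abs_L2T f))\<^sup>2 = (LINT z|circle_measure. (cmod (f z))\<^sup>2)"
proof -
  have "(LINT z|circle_measure. f z * cnj (f z)) = of_real (LINT z|circle_measure. (cmod (f z))\<^sup>2)"
    unfolding complex_norm_square[symmetric] integral_complex_of_real ..
  moreover have "inner (abs_L2T f) (abs_L2T f) = Re (LINT z|circle_measure. f z * cnj (f z))"
    using assms by (subst inner_L2T.abs_eq) auto
  ultimately show ?thesis
    by (simp add: norm_eq_sqrt_inner)
qed

lemma nn_integral_abs_L2T:
  assumes "square_integrable circle_measure f"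
  shows "(\<integral>\<^sup>+z. ennreal ((cmod (f z))\<^sup>2) \<partial>circle_measure) = ennreal ((norm (abs_L2T f))\<^sup>2)"
  unfolding norm_abs_L2T[OF assms] using assms
  by (intro nn_integral_eq_integral) (auto simp: square_integrable_def)

lemma scaleC_L2T_norm: "norm (scaleC_L2T c x) = cmod c * norm x"
proof (cases x rule: abs_L2T_cases)
  case (1 f)
  have "(norm (scaleC_L2T c x))\<^sup>2 = (cmod c * norm x)\<^sup>2"
    using 1 by (simp add: scaleC_L2T_abs norm_abs_L2T square_integrable_cmult norm_mult power_mult_distrib)
  then show ?thesis
    by (metis norm_ge_zero power2_eq_imp_eq zero_le_mult_iff)
qed

lemma scaleC_L2T_diff_left: "scaleC_L2T (a - b) x = scaleC_L2T a x - scaleC_L2T b x"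
  by transfer (auto intro!: square_integrable_diff square_integrable_cmult simp: left_diff_distrib)

lemma scaleC_L2T_scaleC_L2T: "scaleC_L2T a (scaleC_L2T b x) = scaleC_L2T (a * b) x"
  by transfer (auto intro!: square_integrable_cmult simp: mult.assoc)

lemma scaleC_L2T_add_right: "scaleC_L2T a (x + y) = scaleC_L2T a x + scaleC_L2T a y"
  by transfer (auto intro!: square_integrable_add square_integrable_cmult simp: distrib_left)

lemma abs_L2T_0 [simp]: "abs_L2T (\<lambda>z. 0) = 0"
  by (simp add: zero_L2T_def)

lemma scaleC_L2T_0_left [simp]: "scaleC_L2T 0 x = 0"
  by transfer (auto simp: square_integrable_0)

lemma scaleC_L2T_0_right [simp]: "scaleC_L2T c 0 = 0"
  by transfer (auto simp: square_integrable_0)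

lemma square_integrable_of_realD:
  assumes "square_integrable M (\<lambda>z. complex_of_real (u z))"
  shows "u \<in> borel_measurable M"
proof -
  have [measurable]: "(\<lambda>z. complex_of_real (u z)) \<in> borel_measurable M"
    using assms by (simp add: square_integrable_def)
  have "(\<lambda>z. Re (complex_of_real (u z))) \<in> borel_measurable M" by measurable
  then show ?thesis by simp
qed

lemma square_integrable_bound:
  assumes f: "square_integrable M f" and [measurable]: "g \<in> borel_measurable M"
    and le: "\<And>z. cmod (g z) \<le> cmod (f z)"
  shows "square_integrable M g"
  unfolding square_integrable_def
proof
  show "integrable M (\<lambda>z. (cmod (g z))\<^sup>2)"
  proof (rule Bochner_Integration.integrable_bound)
    show "integrable M (\<lambda>z. (cmod (f z))\<^sup>2)"
      using f by (simp add: square_integrable_def)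
    show "AE z in M. norm ((cmod (g z))\<^sup>2) \<le> norm ((cmod (f z))\<^sup>2)"
      using le by (intro AE_I2) (simp add: power_mono)
  qed measurable
qed fact

lemma square_integrable_indicator:
  "A \<in> sets borel \<Longrightarrow> square_integrable circle_measure (indicator A)"
  by (rule square_integrable_circle_bounded[where B=1]) (auto simp: indicator_def)

lemma abs_L2T_tendsto:
  assumes f: "f \<in> borel_measurable circle_measure" and F: "\<And>n. F n \<in> borel_measurable circle_measure"
    and g: "integrable circle_measure (\<lambda>z. (g z)\<^sup>2)"
    and lim: "AE z in circle_measure. (\<lambda>n. F n z) \<longlonglongrightarrow> f z"
    and bound: "\<And>n. AE z in circle_measure. cmod (F n z) \<le> g z"
  shows "square_integrable circle_measure f" "square_integrable circle_measure (F n)"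
    "(\<lambda>n. abs_L2T (F n)) \<longlonglongrightarrow> abs_L2T f"
proof -
  have [measurable]: "f \<in> borel_measurable borel" "\<And>n. F n \<in> borel_measurable borel"
    using f F by auto
  have b: "AE z in circle_measure. (\<forall>n. cmod (F n z) \<le> g z) \<and> cmod (f z) \<le> g z"
  proof -
    have "AE z in circle_measure. \<forall>n. cmod (F n z) \<le> g z"
      using bound by (simp add: AE_all_countable)
    with lim show ?thesis
    proof eventually_elim
      case (elim z)
      then show ?case by (auto intro!: LIMSEQ_le_const2[OF tendsto_norm])
    qed
  qed
  then have bF: "AE z in circle_measure. cmod (F n z) \<le> g z"
    and bf: "AE z in circle_measure. cmod (f z) \<le> g z" for n
    by (auto elim!: eventually_mono)
  have sqF: "square_integrable circle_measure (F n)" for n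
    unfolding square_integrable_def
  proof
    show "integrable circle_measure (\<lambda>x. (cmod (F n x))\<^sup>2)"
      using bF[of n] by (intro Bochner_Integration.integrable_bound[OF g])
         (auto elim!: eventually_mono intro!: power_mono)
  qed (rule F)
  then show "square_integrable circle_measure (F n)" .
  show sqf: "square_integrable circle_measure f"
    unfolding square_integrable_def
  proof
    show "integrable circle_measure (\<lambda>x. (cmod (f x))\<^sup>2)"
      using bf by (intro Bochner_Integration.integrable_bound[OF g])
         (auto elim!: eventually_mono intro!: power_mono)
  qed (rule f)
  have "(\<lambda>n. LINT z|circle_measure. (cmod (F n z - f z))\<^sup>2) \<longlonglongrightarrow> (LINT z|circle_measure. 0)"
  proof (rule integral_dominated_convergence[where w="\<lambda>z. 4 * (g z)\<^sup>2"])
    show "AE z in circle_measure. (\<lambda>n. (cmod (F n z - f z))\<^sup>2) \<longlonglongrightarrow> 0"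
      using lim
    proof eventually_elim
      case (elim z)
      have "(\<lambda>n. (cmod (F n z - f z))\<^sup>2) \<longlonglongrightarrow> (cmod (f z - f z))\<^sup>2"
        by (intro tendsto_intros elim)
      then show ?case by simp
    qed
    show "AE z in circle_measure. norm ((cmod (F n z - f z))\<^sup>2) \<le> 4 * (g z)\<^sup>2" for n
      using b
    proof eventually_elim
      case (elim z)
      have "cmod (F n z - f z) \<le> 2 * g z"
        using elim norm_triangle_ineq4[of "F n z" "f z"] by (smt (verit) spec)
      then have "(cmod (F n z - f z))\<^sup>2 \<le> (2 * g z)\<^sup>2" by (intro power_mono) auto
      then show ?case by (simp add: power_mult_distrib)
    qed
  qed (use g in auto)
  then have "(\<lambda>n. (norm (abs_L2T (F n) - abs_L2T f))\<^sup>2) \<longlonglongrightarrow> 0"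
    using sqF sqf by (simp add: abs_L2T_minus norm_abs_L2T square_integrable_diff)
  then have "(\<lambda>n. sqrt ((norm (abs_L2T (F n) - abs_L2T f))\<^sup>2)) \<longlonglongrightarrow> sqrt 0"
    by (intro tendsto_intros)
  then have "(\<lambda>n. norm (abs_L2T (F n) - abs_L2T f)) \<longlonglongrightarrow> 0"
    by simp
  then show "(\<lambda>n. abs_L2T (F n)) \<longlonglongrightarrow> abs_L2T f"
    by (simp add: LIM_zero_iff tendsto_norm_zero_iff)
qed

instance L2T :: complete_space
proof
  fix X :: "nat \<Rightarrow> L2T" assume X: "Cauchy X"
  have "\<exists>r. strict_mono r \<and> (\<forall>n. \<forall>m\<ge>r n. norm (X m - X (r n)) < (1/2)^n)"
  proof -
    have "\<forall>n. \<exists>N. \<forall>m\<ge>N. \<forall>k\<ge>N. norm (X m - X k) < (1/2)^n"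
      using X by (auto simp: Cauchy_iff)
    then obtain N where N: "\<And>n m k. m \<ge> N n \<Longrightarrow> k \<ge> N n \<Longrightarrow> norm (X m - X k) < (1/2)^n"
      by metis
    define r where "r n = (\<Sum>k\<le>n. Suc (N k))" for n
    have "strict_mono r" by (auto simp: strict_mono_Suc_iff r_def)
    moreover have "r n \<ge> N n" for n
      unfolding r_def by (rule order_trans[OF _ member_le_sum[of n]]) auto
    ultimately show ?thesis
      using N by (intro exI[of _ r]) (meson order_trans)
  qed
  then obtain r where r: "strict_mono r" "\<And>n m. m \<ge> r n \<Longrightarrow> norm (X m - X (r n)) < (1/2)^n"
    by blast
  have "\<forall>n. \<exists>f. square_integrable circle_measure f \<and> X n = abs_L2T f"
    by (metis abs_L2T_cases)
  then obtain F where F: "\<And>n. square_integrable circle_measure (F n)" "\<And>n. X n = abs_L2T (F n)"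
    by metis
  have Fm [measurable]: "F n \<in> borel_measurable borel" for n
    using F(1)[of n] by (auto simp: square_integrable_def)
  have "(\<integral>\<^sup>+z. ennreal (cmod (F (r (Suc n)) z - F (r n) z)) \<partial>circle_measure) \<le> ennreal ((1/2)^n)" for n
  proof -
    let ?d = "\<lambda>z. cmod (F (r (Suc n)) z - F (r n) z)"
    have sq: "square_integrable circle_measure (\<lambda>z. F (r (Suc n)) z - F (r n) z)"
      by (intro square_integrable_diff F)
    have "(LINT z|circle_measure. (?d z)\<^sup>2) \<le> ((1/2)^n)\<^sup>2"
      using r(2)[of n "r (Suc n)"] r(1) sq
      by (auto simp: F(2) abs_L2T_minus F(1) strict_mono_less_eq simp flip: norm_abs_L2T
           intro!: power_mono)
    have int: "integrable circle_measure (\<lambda>z. (?d z)\<^sup>2)"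
      using sq by (auto simp: square_integrable_def)
    have "(\<integral>\<^sup>+z. ennreal (?d z) \<partial>circle_measure) \<le>
        (\<integral>\<^sup>+z. ennreal (((1/2)^n + 2^n * (?d z)\<^sup>2) / 2) \<partial>circle_measure)"
    proof (intro nn_integral_mono ennreal_leI)
      fix z
      have "(1/c + c * d\<^sup>2) / 2 - d = (c * d - 1)\<^sup>2 / (2 * c)" if "c > 0" for c d :: real
        using that by (simp add: field_simps power2_eq_square)
      then have "d \<le> (1/c + c * d\<^sup>2) / 2" if "c > 0" for c d :: real
        using that by (smt (verit) divide_nonneg_pos zero_le_power2)
      from this[of "2^n" "?d z"] show "?d z \<le> ((1/2)^n + 2^n * (?d z)\<^sup>2) / 2"
        by (simp add: power_divide)
    qed
    also have "\<dots> = ennreal (LINT z|circle_measure. ((1/2)^n + 2^n * (?d z)\<^sup>2) / 2)"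
      using int by (intro nn_integral_eq_integral) auto
    also have "(LINT z|circle_measure. ((1/2)^n + 2^n * (?d z)\<^sup>2) / 2) =
        ((1/2)^n + 2^n * (LINT z|circle_measure. (?d z)\<^sup>2)) / 2"
      using int by (simp add: measure_def)
    also have "\<dots> \<le> ((1/2)^n + 2^n * ((1/2)^n)\<^sup>2) / 2"
      using \<open>(LINT z|circle_measure. (?d z)\<^sup>2) \<le> ((1/2)^n)\<^sup>2\<close>
      by (intro divide_right_mono add_left_mono mult_left_mono) auto
    also have "\<dots> = (1/2)^n"
      by (simp add: power2_eq_square power_divide)
    finally show ?thesis using ennreal_leI by (simp add: ennreal_leI)
  qed
  then have "(\<integral>\<^sup>+z. (\<Sum>n. ennreal (cmod (F (r (Suc n)) z - F (r n) z))) \<partial>circle_measure) \<le>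
      (\<Sum>n. ennreal ((1/2)^n))"
    by (subst nn_integral_suminf) (auto intro!: suminf_le)
  also have "(\<Sum>n. ennreal ((1/2)^n)) = ennreal (\<Sum>n. (1/2)^n)"
    by (intro suminf_ennreal2 summable_geometric) auto
  also have "\<dots> < \<infinity>" by simp
  finally have "AE z in circle_measure. (\<Sum>n. ennreal (cmod (F (r (Suc n)) z - F (r n) z))) \<noteq> \<infinity>"
    by (intro nn_integral_PInf_AE) auto
  then have conv: "AE z in circle_measure. convergent (\<lambda>n. F (r n) z)"
  proof eventually_elim
    case (elim z)
    then have "summable (\<lambda>n. cmod (F (r (Suc n)) z - F (r n) z))"
      by (intro summable_suminf_not_top) (auto simp: top_ennreal_def)
    then have "summable (\<lambda>n. F (r (Suc n)) z - F (r n) z)"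
      by (rule summable_norm_cancel)
    then have "convergent (\<lambda>n. \<Sum>k<n. F (r (Suc k)) z - F (r k) z)"
      by (simp add: summable_iff_convergent)
    then have "convergent (\<lambda>n. F (r n) z - F (r 0) z)"
      by (subst (asm) sum_lessThan_telescope[of "\<lambda>n. F (r n) z"])
    then show ?case
      using convergent_diff_const_right_iff[of "\<lambda>n. F (r n) z" "F (r 0) z"] by simp
  qed
  define G where "G z = lim (\<lambda>n. F (r n) z)" for z
  have [measurable]: "G \<in> borel_measurable borel"
    unfolding G_def by measurable
  have lim: "AE z in circle_measure. (\<lambda>n. F (r n) z) \<longlonglongrightarrow> G z"
    using conv by eventually_elim (simp add: G_def convergent_LIMSEQ_iff)
  have Gbound: "(\<integral>\<^sup>+z. ennreal ((cmod (F (r n) z - G z))\<^sup>2) \<partial>circle_measure) \<le> ennreal (((1/2)^n)\<^sup>2)" for n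
  proof -
    have "(\<integral>\<^sup>+z. ennreal ((cmod (F (r n) z - G z))\<^sup>2) \<partial>circle_measure) =
        (\<integral>\<^sup>+z. liminf (\<lambda>m. ennreal ((cmod (F (r n) z - F (r m) z))\<^sup>2)) \<partial>circle_measure)"
    proof (rule nn_integral_cong_AE)
      show "AE z in circle_measure. ennreal ((cmod (F (r n) z - G z))\<^sup>2) =
          liminf (\<lambda>m. ennreal ((cmod (F (r n) z - F (r m) z))\<^sup>2))"
        using lim
      proof eventually_elim
        case (elim z)
        then have "(\<lambda>m. ennreal ((cmod (F (r n) z - F (r m) z))\<^sup>2)) \<longlonglongrightarrow>
            ennreal ((cmod (F (r n) z - G z))\<^sup>2)"
          by (intro tendsto_intros)
        then show ?case by (rule lim_imp_Liminf[symmetric, OF sequentially_bot])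
      qed
    qed
    also have "\<dots> \<le> liminf (\<lambda>m. \<integral>\<^sup>+z. ennreal ((cmod (F (r n) z - F (r m) z))\<^sup>2) \<partial>circle_measure)"
      by (rule nn_integral_liminf) auto
    also have "\<dots> \<le> ennreal (((1/2)^n)\<^sup>2)"
    proof (rule Liminf_le)
      show "\<forall>\<^sub>F m in sequentially. (\<integral>\<^sup>+z. ennreal ((cmod (F (r n) z - F (r m) z))\<^sup>2) \<partial>circle_measure)
          \<le> ennreal (((1/2)^n)\<^sup>2)"
        using eventually_ge_at_top[of n]
      proof eventually_elim
        case (elim m)
        have "norm (X (r n) - X (r m)) \<le> (1/2)^n"
          using r(2)[of n "r m"] elim r(1) by (simp add: strict_mono_less_eq norm_minus_commute less_imp_le)
        then have "(norm (X (r n) - X (r m)))\<^sup>2 \<le> ((1/2)^n)\<^sup>2"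
          by (intro power_mono) auto
        then show ?case
          by (subst nn_integral_abs_L2T) (auto simp: F abs_L2T_minus square_integrable_diff intro!: ennreal_leI)
      qed
    qed auto
    finally show ?thesis .
  qed
  have diff: "square_integrable circle_measure (\<lambda>z. F (r n) z - G z)" for n
    unfolding square_integrable_def
  proof
    show "integrable circle_measure (\<lambda>x. (cmod (F (r n) x - G x))\<^sup>2)"
      using Gbound[of n] by (intro integrableI_bounded) (auto intro: le_less_trans)
  qed simp
  have G: "square_integrable circle_measure G"
    using square_integrable_diff[OF F(1)[of "r 0"] diff[of 0]] by simp
  have "norm (X (r n) - abs_L2T G) \<le> (1/2)^n" for n
  proof -
    have "(norm (X (r n) - abs_L2T G))\<^sup>2 \<le> ((1/2)^n)\<^sup>2"
      using Gbound[of n] diff[of n]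
      by (simp add: F abs_L2T_minus G nn_integral_abs_L2T)
    then show ?thesis by (rule power2_le_imp_le) auto
  qed
  then have "(\<lambda>n. norm (X (r n) - abs_L2T G)) \<longlonglongrightarrow> 0"
    by (intro tendsto_sandwich[OF _ _ tendsto_const LIMSEQ_realpow_zero[of "1/2"]]) auto
  then have "(X \<circ> r) \<longlonglongrightarrow> abs_L2T G"
    by (simp add: o_def LIM_zero_iff tendsto_norm_zero_iff)
  then show "convergent X"
    using Cauchy_converges_subseq[OF X r(1)] by (auto simp: convergent_def)
qed

instance L2T :: banach ..

text \<open>Separability is what the library's Bochner integral asks of its target space.\<close>

instance L2T :: second_countable_topology
proof
  obtain B :: "complex set set" where B: "countable B" "topological_basis B"
    using ex_countable_basis by auto
  define G where "G = Inter ` {F. finite F \<and> F \<subseteq> B}"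
  have G: "countable G" "Int_stable G" "B \<subseteq> G" "UNIV \<in> G"
  proof -
    show "countable G" unfolding G_def
      by (intro countable_image countable_Collect_finite_subset B)
    show "Int_stable G"
    proof (rule Int_stableI)
      fix a b assume "a \<in> G" "b \<in> G"
      then obtain F F' where "a = \<Inter>F" "b = \<Inter>F'" "finite F" "finite F'" "F \<subseteq> B" "F' \<subseteq> B"
        by (auto simp: G_def)
      then show "a \<inter> b \<in> G"
        unfolding G_def by (intro image_eqI[of _ _ "F \<union> F'"]) auto
    qed
    show "B \<subseteq> G"
    proof
      fix b assume "b \<in> B" then show "b \<in> G"
        unfolding G_def by (intro image_eqI[of _ _ "{b}"]) auto
    qed
    show "UNIV \<in> G" unfolding G_def by (intro image_eqI[of _ _ "{}"]) auto
  qed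
  have openG: "open g" if "g \<in> G" for g
    using that B(2) by (auto simp: G_def intro!: open_Inter dest: topological_basis_open)
  have borelG: "sets borel = sigma_sets UNIV G"
  proof -
    have "sets borel = sigma_sets UNIV B"
      by (simp add: borel_eq_countable_basis[OF B])
    moreover have "sigma_sets UNIV B \<subseteq> sigma_sets UNIV G"
      by (rule sigma_sets_mono) (use G(3) in \<open>auto intro: sigma_sets.Basic\<close>)
    moreover have "sigma_sets UNIV G \<subseteq> sigma_sets UNIV (sets borel)"
      by (rule sigma_sets_mono) (use openG in \<open>auto intro: sigma_sets.Basic\<close>)
    moreover have "sigma_sets UNIV (sets borel) = sets (borel :: complex measure)"
      using sets.sigma_sets_eq[of "borel :: complex measure"] by simp
    ultimately show ?thesis by auto
  qed
  define item where
    "item = (\<lambda>(p :: rat, q :: rat, k). scaleC_L2T (Complex (of_rat p) (of_rat q))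
               (abs_L2T (indicator (from_nat_into G k))))"
  define D where "D = range (\<lambda>xs. sum_list (map item xs))"
  have "countable D" unfolding D_def by auto
  have D_add: "x + y \<in> D" if xy: "x \<in> D" "y \<in> D" for x y
  proof -
    obtain xs ys where "x = sum_list (map item xs)" "y = sum_list (map item ys)"
      using xy unfolding D_def by blast
    then have "x + y = sum_list (map item (xs @ ys))" by simp
    then show ?thesis unfolding D_def by blast
  qed
  define V where "V = closure D"
  have "closed V" by (simp add: V_def)
  have V_add: "x + y \<in> V" if xy: "x \<in> V" "y \<in> V" for x y
  proof -
    obtain a b where "\<And>n. a n \<in> D" "a \<longlonglongrightarrow> x" "\<And>n. b n \<in> D" "b \<longlonglongrightarrow> y"
      using xy unfolding V_def closure_sequential by blast
    then show ?thesis
      unfolding V_def closure_sequential by (intro exI[of _ "\<lambda>n. a n + b n"]) (auto intro: D_add tendsto_add)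
  qed
  have V_lim: "x \<in> V" if "\<And>n. a n \<in> V" "a \<longlonglongrightarrow> x" for a x
    using closed_sequentially[OF \<open>closed V\<close>] that by blast
  have V_G: "scaleC_L2T w (abs_L2T (indicator g)) \<in> V" if g: "g \<in> G" for w g
    unfolding V_def closure_approachable
  proof safe
    fix e :: real assume e: "e > 0"
    define N where "N = norm (abs_L2T (indicator g)) + 1"
    have N: "N > 0" by (simp add: N_def add_nonneg_pos)
    obtain p where p: "p \<in> \<rat>" "\<bar>Re w - p\<bar> < e / (2 * N)"
      using rational_approximation[of "e / (2 * N)" "Re w"] e N by (auto simp: abs_minus_commute)
    obtain q where q: "q \<in> \<rat>" "\<bar>Im w - q\<bar> < e / (2 * N)"
      using rational_approximation[of "e / (2 * N)" "Im w"] e N by (auto simp: abs_minus_commute)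
    obtain p' q' where pq': "p = of_rat p'" "q = of_rat q'"
      using p q by (auto elim!: Rats_cases)
    obtain k where k: "g = from_nat_into G k"
      using g G(1) by (metis from_nat_into_surj)
    have "cmod (Complex p q - w) \<le> \<bar>Re (Complex p q - w)\<bar> + \<bar>Im (Complex p q - w)\<bar>"
      by (rule cmod_le)
    also have "\<dots> < e / (2 * N) + e / (2 * N)"
      using p q by auto
    also have "\<dots> = e / N" using N by (simp add: field_simps)
    finally have c: "cmod (Complex p q - w) < e / N" .
    have "dist (item (p', q', k)) (scaleC_L2T w (abs_L2T (indicator g))) =
        cmod (Complex p q - w) * norm (abs_L2T (indicator g))"
      by (simp add: item_def k[symmetric] pq' dist_norm scaleC_L2T_norm flip: scaleC_L2T_diff_left)
    also have "\<dots> \<le> cmod (Complex p q - w) * N"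
      by (intro mult_left_mono) (auto simp: N_def)
    also have "\<dots> < e" using c N by (simp add: field_simps)
    finally have "dist (item (p', q', k)) (scaleC_L2T w (abs_L2T (indicator g))) < e" .
    moreover have "item (p', q', k) \<in> D"
      unfolding D_def by (rule range_eqI[of _ _ "[(p', q', k)]"]) simp
    ultimately show "\<exists>y\<in>D. dist y (scaleC_L2T w (abs_L2T (indicator g))) < e" by blast
  qed
  have V_0: "0 \<in> V" using V_G[OF G(4), of 0] by simp
  have disj_ind: "indicator (a \<union> b) = (\<lambda>z. indicator a z + indicator b z :: complex)"
    if "a \<inter> b = {}" for a b :: "complex set"
    using that by (auto simp: fun_eq_iff indicator_def)
  have V_borel: "scaleC_L2T w (abs_L2T (indicator A)) \<in> V" if "A \<in> sets borel" for w A
  proof -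
    have "A \<in> sigma_sets UNIV G" using that borelG by simp
    have GPow: "G \<subseteq> Pow UNIV" by simp
    from \<open>A \<in> sigma_sets UNIV G\<close> have "\<forall>w. scaleC_L2T w (abs_L2T (indicator A)) \<in> V"
    proof (induction rule: sigma_sets_induct_disjoint[OF G(2) GPow, consumes 1, case_names basic empty compl union])
      case (basic A)
      then show ?case using V_G by blast
    next
      case empty
      show ?case using V_0 by simp
    next
      case (compl A)
      then have A: "A \<in> sets borel" using borelG by simp
      have i: "square_integrable circle_measure (indicator A)"
        "square_integrable circle_measure (indicator UNIV)"
        "square_integrable circle_measure (indicator (UNIV - A))"
        by (rule square_integrable_indicator; use A in auto)+
      have "scaleC_L2T w (abs_L2T (indicator (UNIV - A))) =
          scaleC_L2T w (abs_L2T (indicator UNIV)) + scaleC_L2T (-w) (abs_L2T (indicator A))" for w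
      proof -
        have "scaleC_L2T w (abs_L2T (indicator (UNIV - A))) =
            abs_L2T (\<lambda>z. w * indicator UNIV z + (- w) * indicator A z)"
          unfolding scaleC_L2T_abs[OF i(3)]
          by (intro arg_cong[where f=abs_L2T] ext) (auto simp: indicator_def)
        then show ?thesis
          by (simp only: scaleC_L2T_abs[OF i(1)] scaleC_L2T_abs[OF i(2)] abs_L2T_plus
              square_integrable_cmult i)
      qed
      then show ?case using V_add V_G[OF G(4)] compl by auto
    next
      case (union A)
      have A: "A i \<in> sets borel" for i using union borelG by auto
      show ?case
      proof
        fix w
        have fin: "scaleC_L2T w (abs_L2T (indicator (\<Union>i<n. A i))) \<in> V" for n
        proof (induction n)
          case 0
          show ?case using V_0 by simp
        next
          case (Suc n)
          have [measurable]: "(\<Union>i<n. A i) \<in> sets borel" using A by auto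
          have "A i \<inter> A n = {}" if "i < n" for i
            using union.hyps(1) that by (auto simp: disjoint_family_on_def)
          then have disj: "(\<Union>i<n. A i) \<inter> A n = {}" by blast
          have "(\<Union>i<Suc n. A i) = (\<Union>i<n. A i) \<union> A n"
            by (auto simp: lessThan_Suc)
          then have ind: "indicator (\<Union>i<Suc n. A i) =
              (\<lambda>z. indicator (\<Union>i<n. A i) z + indicator (A n) z :: complex)"
            by (simp only: disj_ind[OF disj])
          have "scaleC_L2T w (abs_L2T (indicator (\<Union>i<Suc n. A i))) =
            scaleC_L2T w (abs_L2T (indicator (\<Union>i<n. A i))) + scaleC_L2T w (abs_L2T (indicator (A n)))"
            using A unfolding ind
            by (simp add: abs_L2T_plus square_integrable_indicator flip: scaleC_L2T_add_right)
          then show ?case using Suc union V_add by auto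
        qed
        have "(\<lambda>n. abs_L2T (\<lambda>z. w * indicator (\<Union>i<n. A i) z)) \<longlonglongrightarrow>
            abs_L2T (\<lambda>z. w * indicator (\<Union>i. A i) z)"
        proof (rule abs_L2T_tendsto(3)[where g="\<lambda>_. cmod w"])
          show "AE z in circle_measure. (\<lambda>n. w * indicator (\<Union>i<n. A i) z) \<longlonglongrightarrow> w * indicator (\<Union>i. A i) z"
            by (intro AE_I2 tendsto_intros LIMSEQ_indicator_UN)
          show "AE z in circle_measure. cmod (w * indicator (\<Union>i<n. A i) z) \<le> cmod w" for n
            by (auto simp: indicator_def norm_mult)
        qed (use A in auto)
        then have "(\<lambda>n. scaleC_L2T w (abs_L2T (indicator (\<Union>i<n. A i)))) \<longlonglongrightarrow>
            scaleC_L2T w (abs_L2T (indicator (\<Union>i. A i)))"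
          using A by (simp add: scaleC_L2T_abs square_integrable_indicator sets.finite_UN)
        then show "scaleC_L2T w (abs_L2T (indicator (\<Union>i. A i))) \<in> V"
          by (rule V_lim[OF fin])
      qed
    qed
    then show ?thesis ..
  qed
  have V_real: "scaleC_L2T w (abs_L2T (\<lambda>z. complex_of_real (u z))) \<in> V"
    if "square_integrable circle_measure (\<lambda>z. complex_of_real (u z))" "\<And>z. 0 \<le> u z" for u w
  proof -
    have u: "u \<in> borel_measurable borel"
      using square_integrable_of_realD[OF that(1)] by simp
    show ?thesis using u that(2) that(1)
    proof (induction arbitrary: w rule: borel_measurable_induct_real)
      case (set A)
      then show ?case using V_borel[of A w] by (simp add: of_real_indicator)
    next
      case (mult u c)
      show ?case
      proof (cases "c = 0")
        case True
        then show ?thesis using V_0 by simp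
      next
        case False
        have u: "square_integrable circle_measure (\<lambda>z. complex_of_real (u z))"
          using square_integrable_cmult[OF mult.prems, of "complex_of_real (1/c)"] False by simp
        show ?thesis
          using mult.IH[OF u, of "w * of_real c"] u
          by (simp add: scaleC_L2T_abs square_integrable_cmult mult.assoc)
      qed
    next
      case (add u v)
      have u: "square_integrable circle_measure (\<lambda>z. complex_of_real (u z))"
      proof (rule square_integrable_bound[OF add.prems])
        show "(\<lambda>z. complex_of_real (u z)) \<in> borel_measurable circle_measure"
          using add.hyps by simp
        show "cmod (complex_of_real (u z)) \<le> cmod (complex_of_real (v z + u z))" for z
          using add.hyps(2)[of z] add.hyps(4)[of z] by (simp only: norm_of_real)
      qed
      have v: "square_integrable circle_measure (\<lambda>z. complex_of_real (v z))"
      proof (rule square_integrable_bound[OF add.prems])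
        show "(\<lambda>z. complex_of_real (v z)) \<in> borel_measurable circle_measure"
          using add.hyps by simp
        show "cmod (complex_of_real (v z)) \<le> cmod (complex_of_real (v z + u z))" for z
          using add.hyps(2)[of z] add.hyps(4)[of z] by (simp only: norm_of_real)
      qed
      have "scaleC_L2T w (abs_L2T (\<lambda>z. complex_of_real (v z + u z))) =
         scaleC_L2T w (abs_L2T (\<lambda>z. complex_of_real (v z))) + scaleC_L2T w (abs_L2T (\<lambda>z. complex_of_real (u z)))"
        using u v by (simp add: abs_L2T_plus flip: scaleC_L2T_add_right)
      then show ?case using V_add add.IH u v by simp
    next
      case (seq U)
      have le: "U i z \<le> u z" for i z
        using seq.hyps by (intro incseq_le[of "\<lambda>i. U i z"]) (auto simp: incseq_def le_fun_def)
      have *: "(\<lambda>n. abs_L2T (\<lambda>z. w * complex_of_real (U n z))) \<longlonglongrightarrow> abs_L2T (\<lambda>z. w * complex_of_real (u z))"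
        "square_integrable circle_measure (\<lambda>z. complex_of_real (U n z))" for n
      proof -
        have [measurable]: "\<And>i. U i \<in> borel_measurable borel" using seq.hyps by simp
        have [measurable]: "u \<in> borel_measurable borel"
          using square_integrable_of_realD[OF seq.prems] by simp
        have int: "integrable circle_measure (\<lambda>z. (u z)\<^sup>2)"
          using seq.prems by (simp add: square_integrable_def)
        show "(\<lambda>n. abs_L2T (\<lambda>z. w * complex_of_real (U n z))) \<longlonglongrightarrow> abs_L2T (\<lambda>z. w * complex_of_real (u z))"
        proof (rule abs_L2T_tendsto(3)[where g="\<lambda>z. cmod w * u z"])
          show "AE z in circle_measure. (\<lambda>n. w * complex_of_real (U n z)) \<longlonglongrightarrow> w * complex_of_real (u z)"
            using seq.hyps by (intro AE_I2 tendsto_intros) auto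
          show "AE z in circle_measure. cmod (w * complex_of_real (U n z)) \<le> cmod w * u z" for n
            using seq.hyps le by (auto simp: norm_mult intro!: mult_left_mono)
        qed (use int in \<open>auto simp: power_mult_distrib\<close>)
        show "square_integrable circle_measure (\<lambda>z. complex_of_real (U n z))"
        proof (rule square_integrable_bound[OF seq.prems])
          show "cmod (complex_of_real (U n z)) \<le> cmod (complex_of_real (u z))" for z
            using le[of n z] seq.hyps(2)[of n z] by (simp only: norm_of_real)
        qed measurable
      qed
      then have "(\<lambda>n. scaleC_L2T w (abs_L2T (\<lambda>z. complex_of_real (U n z)))) \<longlonglongrightarrow>
           scaleC_L2T w (abs_L2T (\<lambda>z. complex_of_real (u z)))"
        using seq.prems by (simp add: scaleC_L2T_abs)
      then show ?case by (rule V_lim[OF seq.IH[OF *(2)]])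
    qed
  qed
  have V_all: "x \<in> V" for x
  proof (cases x rule: abs_L2T_cases)
    case (1 f)
    have [measurable]: "f \<in> borel_measurable borel"
      using 1 by (auto simp: square_integrable_def)
    have bd: "square_integrable circle_measure (\<lambda>z. complex_of_real (h (f z)))"
      if [measurable]: "h \<in> borel_measurable borel" and "\<And>z. \<bar>h z\<bar> \<le> cmod z" for h
      by (rule square_integrable_bound[OF 1(1)]) (use that(2) in auto)
    let ?a = "\<lambda>z. max 0 (Re z)" and ?b = "\<lambda>z. max 0 (- Re z)"
    let ?c = "\<lambda>z. max 0 (Im z)" and ?d = "\<lambda>z. max 0 (- Im z)"
    have aux: "Re z \<le> cmod z" "- Re z \<le> cmod z" "Im z \<le> cmod z" "- Im z \<le> cmod z" for z
      using abs_Re_le_cmod[of z] abs_Im_le_cmod[of z] by linarith+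
    have sq: "square_integrable circle_measure (\<lambda>z. complex_of_real (?a (f z)))"
      "square_integrable circle_measure (\<lambda>z. complex_of_real (?b (f z)))"
      "square_integrable circle_measure (\<lambda>z. complex_of_real (?c (f z)))"
      "square_integrable circle_measure (\<lambda>z. complex_of_real (?d (f z)))"
      by (rule bd; use aux in \<open>auto simp: max_def\<close>)+
    have eq: "f z = 1 * complex_of_real (?a (f z)) + (-1) * complex_of_real (?b (f z)) +
       \<i> * complex_of_real (?c (f z)) + (-\<i>) * complex_of_real (?d (f z))" for z
      by (simp add: complex_eq_iff max_def)
    have "x = scaleC_L2T 1 (abs_L2T (\<lambda>z. complex_of_real (?a (f z)))) +
       scaleC_L2T (-1) (abs_L2T (\<lambda>z. complex_of_real (?b (f z)))) +
       scaleC_L2T \<i> (abs_L2T (\<lambda>z. complex_of_real (?c (f z)))) +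
       scaleC_L2T (-\<i>) (abs_L2T (\<lambda>z. complex_of_real (?d (f z))))"
      unfolding 1(2) using sq
      by (simp only: scaleC_L2T_abs abs_L2T_plus square_integrable_cmult square_integrable_add eq[symmetric])
    also have "\<dots> \<in> V" by (intro V_add V_real sq) auto
    finally show ?thesis .
  qed
  define BB where "BB = (\<lambda>(d, n). ball d (1 / real (Suc n))) ` (D \<times> (UNIV :: nat set))"
  have "countable BB" unfolding BB_def using \<open>countable D\<close> by auto
  moreover have "topological_basis BB"
  proof (rule topological_basisI)
    fix S and x :: L2T assume "open S" "x \<in> S"
    then obtain e where e: "e > 0" "ball x e \<subseteq> S" by (auto simp: open_contains_ball)
    obtain n where n: "1 / real (Suc n) < e / 2"
      using e(1) nat_approx_posE[of "e/2"] by auto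
    obtain d where d: "d \<in> D" "dist d x < 1 / real (Suc n)"
      using V_all[of x] unfolding V_def closure_approachable
      by (metis of_nat_0_less_iff zero_less_Suc zero_less_divide_1_iff)
    have "ball d (1 / real (Suc n)) \<subseteq> ball x e"
    proof
      fix y assume "y \<in> ball d (1 / real (Suc n))"
      then show "y \<in> ball x e"
        using d n dist_triangle[of x y d] by (simp add: dist_commute)
    qed
    then show "\<exists>B'\<in>BB. x \<in> B' \<and> B' \<subseteq> S"
      using d e by (intro bexI[of _ "ball d (1 / real (Suc n))"]) (auto simp: BB_def)
  qed (auto simp: BB_def)
  ultimately show "\<exists>B :: L2T set set. countable B \<and> open = generate_topology B"
    using topological_basis_imp_subbasis by blast
qed

section \<open>The \<open>H\<^sup>2\<close> control system\<close>

lift_definition fourier_coeff :: "L2T \<Rightarrow> int \<Rightarrow> complex"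
  is "\<lambda>f n. LINT z|circle_measure. f z * z powi (- n)"
  by (rule ext, rule integral_cong_AE) (auto simp: square_integrable_def elim!: eventually_mono
     intro!: borel_measurable_times square_integrable_powi[unfolded square_integrable_def, THEN conjunct1, simplified])

definition riesz_projector :: "L2T \<Rightarrow> L2T" where
  "riesz_projector f = (\<Sum>\<^sub>\<infinity>n\<in>{0..}. scaleC_L2T (fourier_coeff f n) (monomial_L2T n))"

definition H2 :: "L2T set" where
  "H2 = range riesz_projector"

definition disk_function :: "L2T \<Rightarrow> complex \<Rightarrow> complex" where
  "disk_function f z = (\<Sum>n. fourier_coeff f (int n) * z ^ n)"

definition extends_to_larger_disk :: "L2T \<Rightarrow> bool" where
  "extends_to_larger_disk f \<longleftrightarrow>
     (\<exists>r>1. \<exists>F. F holomorphic_on ball 0 r \<and> (\<forall>z\<in>ball 0 1. F z = disk_function f z))"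

definition semigroup_S :: "real \<Rightarrow> L2T \<Rightarrow> L2T" where
  "semigroup_S t f =
     (\<Sum>\<^sub>\<infinity>n. scaleC_L2T (fourier_coeff f n * of_real (exp (- \<bar>of_int n\<bar> * t))) (monomial_L2T n))"

text \<open>The almost-everywhere class of a function; the value \<open>0\<close> at functions that are not square integrable only
  matters for null sets of times in \<open>final_state\<close>, where it keeps the integrand measurable.\<close>

definition L2T_of :: "(complex \<Rightarrow> complex) \<Rightarrow> L2T" where
  "L2T_of f = (if square_integrable circle_measure f then abs_L2T f else 0)"

definition is_control :: "complex set \<Rightarrow> real \<Rightarrow> (real \<times> complex \<Rightarrow> complex) \<Rightarrow> bool" where
  "is_control \<omega> T u \<longleftrightarrow>
     square_integrable (restrict_space lborel {0..T} \<Otimes>\<^sub>M restrict_space circle_measure \<omega>) u"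

text \<open>The Bochner integral is taken in \<open>L2T\<close>, and \<open>u (s, \<cdot>)\<close> is extended by \<open>0\<close> outside \<open>\<omega>\<close>.\<close>

definition final_state ::
  "complex set \<Rightarrow> real \<Rightarrow> L2T \<Rightarrow> (real \<times> complex \<Rightarrow> complex) \<Rightarrow> L2T" where
  "final_state \<omega> T f\<^sub>0 u = semigroup_S T f\<^sub>0 +
     (LINT s:{0..T}|lborel.
        semigroup_S (T - s) (riesz_projector (L2T_of (\<lambda>z. if z \<in> \<omega> then u (s, z) else 0))))"

definition NC_H2 :: "complex set \<Rightarrow> real \<Rightarrow> L2T set" where
  "NC_H2 \<omega> T = {f\<^sub>0 \<in> H2. \<exists>u. is_control \<omega> T u \<and> final_state \<omega> T f\<^sub>0 u = 0}"

lemma fourier_coeff_monomial: "fourier_coeff (scaleC_L2T c (monomial_L2T m)) n = (if n = m then c else 0)"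
proof -
  have meas [measurable]: "(\<lambda>z::complex. z powi k) \<in> borel_measurable borel" for k
    using square_integrable_powi[of k] unfolding square_integrable_def
    by (simp cong: measurable_cong_sets)
  have "fourier_coeff (scaleC_L2T c (monomial_L2T m)) n =
      (LINT z|circle_measure. c * z powi m * z powi (- n))"
    unfolding monomial_L2T.abs_eq scaleC_L2T_abs[OF square_integrable_powi]
    by (subst fourier_coeff.abs_eq) (auto intro: square_integrable_cmult square_integrable_powi)
  also have "\<dots> = (LINT z|circle_measure. c * z powi (m - n))"
  proof (rule integral_cong_AE)
    show "AE z in circle_measure. c * z powi m * z powi (- n) = c * z powi (m - n)"
      using AE_circle_norm
    proof eventually_elim
      case (elim z)
      then have "z \<noteq> 0" by auto
      then show ?case by (simp add: power_int_diff power_int_minus field_simps)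
    qed
  qed auto
  also have "\<dots> = (LINT x|uniform_measure lborel {0..2*pi}. c * cis (of_int (m - n) * x))"
    unfolding circle_measure_def by (subst integral_distr) (auto simp: cis_power_int)
  also have "\<dots> = (if n = m then c else 0)"
  proof -
    have unif: "uniform_measure lborel {0..2*pi} =
        density lborel (\<lambda>x. ennreal (indicator {0..2*pi} x / (2 * pi)))"
      unfolding uniform_measure_def
      by (intro arg_cong[where f="density lborel"] ext)
         (auto simp: indicator_def divide_ennreal simp flip: ennreal_1)
    have "(LINT x|uniform_measure lborel {0..2*pi}. c * cis (of_int (m - n) * x)) =
        (LINT x|lborel. (indicator {0..2*pi} x / (2 * pi)) *\<^sub>R (c * cis (of_int (m - n) * x)))"
      unfolding unif by (subst integral_density) (auto simp: indicator_def)
    also have "\<dots> = (LINT x|lborel. indicator {0..2*pi} x *\<^sub>R (c / (2 * pi) * cis (of_int (m - n) * x)))"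
      by (intro Bochner_Integration.integral_cong) (auto simp: indicator_def scaleR_conv_of_real)
    also have "\<dots> = (if n = m then c else 0)"
    proof (cases "n = m")
      case True
      then show ?thesis by (simp add: scaleR_conv_of_real)
    next
      case False
      define k where "k = complex_of_int (m - n)"
      have k: "k \<noteq> 0" using False by (simp add: k_def)
      have cis: "cis (of_int (m - n) * x) = exp (\<i> * k * of_real x)" for x
        by (simp add: cis_conv_exp k_def mult_ac)
      have "(LINT x|lborel. indicator {0..2*pi} x *\<^sub>R (c / (2 * pi) * exp (\<i> * k * of_real x))) =
        c / (2 * pi) * exp (\<i> * k * of_real (2 * pi)) / (\<i> * k) -
        c / (2 * pi) * exp (\<i> * k * of_real 0) / (\<i> * k)"
      proof (rule integral_FTC_atLeastAtMost)
        show "((\<lambda>x. c / (2 * pi) * exp (\<i> * k * of_real x) / (\<i> * k)) has_vector_derivative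
            c / (2 * pi) * exp (\<i> * k * of_real x)) (at x within {0..2*pi})" for x
          by (rule has_vector_derivative_real_field)
             (use k in \<open>auto intro!: derivative_eq_intros\<close>)
      qed (auto intro!: continuous_intros)
      also have "exp (\<i> * k * of_real (2 * pi)) = 1"
        using cis_multiple_2pi[of "of_int (m - n)"] cis[of "2 * pi"] by (simp add: mult_ac)
      finally show ?thesis unfolding cis using False by simp
    qed
    finally show ?thesis .
  qed
  finally show ?thesis .
qed


lemma riesz_projector_const: "riesz_projector (scaleC_L2T c (monomial_L2T 0)) = scaleC_L2T c (monomial_L2T 0)"
proof -
  have "riesz_projector (scaleC_L2T c (monomial_L2T 0)) =
      (\<Sum>\<^sub>\<infinity>n\<in>{0}. scaleC_L2T (fourier_coeff (scaleC_L2T c (monomial_L2T 0)) n) (monomial_L2T n))"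
    unfolding riesz_projector_def
    by (rule infsum_cong_neutral) (auto simp: fourier_coeff_monomial)
  then show ?thesis by (simp add: fourier_coeff_monomial)
qed

lemma semigroup_S_const: "semigroup_S t (scaleC_L2T c (monomial_L2T 0)) = scaleC_L2T c (monomial_L2T 0)"
proof -
  have "semigroup_S t (scaleC_L2T c (monomial_L2T 0)) =
      (\<Sum>\<^sub>\<infinity>n\<in>{0}. scaleC_L2T (fourier_coeff (scaleC_L2T c (monomial_L2T 0)) n *
         of_real (exp (- \<bar>of_int n\<bar> * t))) (monomial_L2T n))"
    unfolding semigroup_S_def
    by (rule infsum_cong_neutral) (auto simp: fourier_coeff_monomial)
  then show ?thesis by (simp add: fourier_coeff_monomial)
qed

lemma scaleR_L2T_conv_scaleC_L2T: "r *\<^sub>R x = scaleC_L2T (of_real r) x" for x :: L2T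
  by transfer (auto intro!: square_integrable_cmult)

lemma scaleC_L2T_uminus_1: "scaleC_L2T (- 1) x = - x"
  by transfer (auto intro!: square_integrable_uminus)

lemma scaleC_L2T_1: "scaleC_L2T 1 x = x"
  by transfer auto

lemma AE_circle_neq_1: "AE z in circle_measure. z \<noteq> 1"
proof -
  have "AE x in lborel. x \<noteq> (0::real)" "AE x in lborel. x \<noteq> 2 * pi"
    by (rule AE_lborel_singleton)+
  then have "AE x in lborel. x \<in> {0..2*pi} \<longrightarrow> cis x \<noteq> 1"
  proof eventually_elim
    case (elim x)
    show ?case
    proof (intro impI notI)
      assume x: "x \<in> {0..2*pi}" and "cis x = 1"
      then have "cos x = 1" by (metis cis.sel(1) one_complex.sel(1))
      then obtain n :: int where n: "x = n * 2 * pi" by (auto simp: cos_one_2pi_int)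
      with x have "0 \<le> real_of_int n" "real_of_int n \<le> 1"
        using pi_gt_zero by (auto simp: zero_le_mult_iff)
      then have "n = 0 \<or> n = 1" by linarith
      then have "x = 0 \<or> x = 2 * pi" using n by auto
      then show False using elim by auto
    qed
  qed
  then have "AE x in uniform_measure lborel {0..2*pi}. cis x \<noteq> 1"
    by (intro AE_uniform_measureI) auto
  then show ?thesis
    unfolding circle_measure_def by (subst AE_distr_iff) auto
qed

text \<open>Why the control region of the theorem is assumed not to be dense in the circle, rather than
  merely different from it: if the complement of \<open>\<omega>\<close> is a single point, then the control
  \<open>u = - 1 / T\<close> steers the constant function \<open>1\<close> to \<open>0\<close>, see \<open>proper_open_not_sufficient\<close>.\<close>

lemma const_null_controllable:
  assumes T: "T > 0"
  shows "monomial_L2T 0 \<in> NC_H2 (sphere 0 1 - {1}) T"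
proof -
  let ?\<omega> = "sphere 0 1 - {1 :: complex}"
  let ?e = "monomial_L2T 0"
  define u :: "real \<times> complex \<Rightarrow> complex" where "u = (\<lambda>_. - of_real (1 / T))"
  interpret A: finite_measure "restrict_space lborel {0..T}"
    by (rule finite_measureI) (use T in \<open>auto simp: emeasure_restrict_space space_restrict_space\<close>)
  have \<omega>: "?\<omega> \<in> sets borel" by (auto intro!: borel_closed)
  interpret B: finite_measure "restrict_space circle_measure ?\<omega>"
    by (rule finite_measureI) (use \<omega> in \<open>auto simp: emeasure_restrict_space space_restrict_space\<close>)
  interpret finite_measure "restrict_space lborel {0..T} \<Otimes>\<^sub>M restrict_space circle_measure ?\<omega>"
    by (rule finite_measure_pair_measure) unfold_locales
  have ctrl: "is_control ?\<omega> T u"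
    unfolding is_control_def square_integrable_def u_def by (simp add: norm_divide)
  have one: "square_integrable circle_measure (\<lambda>z. c)" for c
    by (rule square_integrable_circle_bounded[where B="cmod c"]) auto
  have "L2T_of (\<lambda>z. if z \<in> ?\<omega> then u (s, z) else 0) = scaleC_L2T (- of_real (1/T)) ?e" for s
  proof -
    have m: "(\<lambda>z. if z \<in> ?\<omega> then u (s, z) else 0) \<in> borel_measurable borel"
      unfolding u_def using \<omega> by (intro measurable_If_set) auto
    have "square_integrable circle_measure (\<lambda>z. if z \<in> ?\<omega> then u (s, z) else 0)"
      by (rule square_integrable_circle_bounded[where B="1/T"]) (use m T in \<open>auto simp: u_def norm_divide\<close>)
    then have "L2T_of (\<lambda>z. if z \<in> ?\<omega> then u (s, z) else 0) = abs_L2T (\<lambda>z. - of_real (1/T) * 1)"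
      unfolding L2T_of_def using AE_circle_norm AE_circle_neq_1
      by (auto intro!: abs_L2T_eqI one simp: u_def elim!: eventually_elim2)
    also have "\<dots> = scaleC_L2T (- of_real (1/T)) ?e"
      unfolding monomial_L2T.abs_eq by (subst scaleC_L2T_abs) (auto simp: one)
    finally show ?thesis .
  qed
  then have "final_state ?\<omega> T ?e u =
      semigroup_S T (scaleC_L2T 1 ?e) + (LINT s:{0..T}|lborel. scaleC_L2T (- of_real (1/T)) ?e)"
    unfolding final_state_def by (simp only: riesz_projector_const semigroup_S_const[of _ "- of_real (1/T)"] scaleC_L2T_1)
  also have "\<dots> = ?e + T *\<^sub>R scaleC_L2T (- of_real (1/T)) ?e"
    using T unfolding semigroup_S_const unfolding scaleC_L2T_1
    by (simp add: set_lebesgue_integral_def)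
  also have "T *\<^sub>R scaleC_L2T (- of_real (1/T)) ?e = - ?e"
    using T by (simp add: scaleR_L2T_conv_scaleC_L2T scaleC_L2T_scaleC_L2T scaleC_L2T_uminus_1)
  finally have "final_state ?\<omega> T ?e u = 0" by simp
  moreover have "?e \<in> H2"
    unfolding H2_def using riesz_projector_const[of 1] by (metis scaleC_L2T_1 rangeI)
  ultimately show ?thesis
    unfolding NC_H2_def using ctrl by blast
qed

lemma const_extends: "extends_to_larger_disk (monomial_L2T 0)"
proof -
  have c: "fourier_coeff (monomial_L2T 0) n = (if n = 0 then 1 else 0)" for n
    using fourier_coeff_monomial[of 1 0 n] by (simp add: scaleC_L2T_1)
  have "disk_function (monomial_L2T 0) z = 1" for z
  proof -
    have "disk_function (monomial_L2T 0) z = (\<Sum>n\<in>{0::nat}. fourier_coeff (monomial_L2T 0) (int n) * z ^ n)"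
      unfolding disk_function_def by (rule suminf_finite) (auto simp: c)
    then show ?thesis by (simp add: c)
  qed
  then show ?thesis
    unfolding extends_to_larger_disk_def
    by (intro exI[of _ 2] conjI exI[of _ "\<lambda>_. 1"]) auto
qed

lemma const_neq_0: "monomial_L2T 0 \<noteq> 0"
proof
  assume "monomial_L2T 0 = 0"
  then show False using fourier_coeff_monomial[of 1 0 0] fourier_coeff_monomial[of 0 0 0]
    by (simp add: scaleC_L2T_1)
qed

lemma proper_open_not_sufficient:
  assumes "T > 0"
  shows "\<exists>\<omega> f\<^sub>0. openin (top_of_set (sphere 0 1)) \<omega> \<and> \<omega> \<noteq> sphere 0 1 \<and> f\<^sub>0 \<in> H2 \<and>
    extends_to_larger_disk f\<^sub>0 \<and> f\<^sub>0 \<in> NC_H2 \<omega> T \<and> f\<^sub>0 \<noteq> 0"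
proof -
  have "openin (top_of_set (sphere 0 1)) (sphere 0 1 - {1 :: complex})"
    unfolding openin_open by (rule exI[of _ "- {1}"]) (simp add: open_Compl Diff_eq)
  moreover have "(1 :: complex) \<in> sphere 0 1" by simp
  then have "sphere 0 1 - {1 :: complex} \<noteq> sphere 0 1" by blast
  moreover have "monomial_L2T 0 \<in> NC_H2 (sphere 0 1 - {1}) T"
    by (rule const_null_controllable[OF assms])
  moreover from this have "monomial_L2T 0 \<in> H2"
    by (simp add: NC_H2_def)
  ultimately show ?thesis
    using const_extends const_neq_0 by blast
qed

end

theory Submission
  imports Defs
begin

text \<open>Testing the final state against \<open>z powi n\<close> turns null controllability into the moment problem
  \<open>a\<^sub>n = - \<integral> u(s, z) (e\<^sup>s / z)\<^sup>n\<close> for the Taylor coefficients \<open>a\<^sub>n\<close> of \<open>f\<^sub>0\<close>.  Hence near \<open>0\<close> the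
  function \<open>f\<^sub>0\<close> is the Cauchy transform of a measure carried by the annular sector of the points
  \<open>e\<^sup>-\<^sup>s z\<close> with \<open>s \<in> [0, T]\<close> and \<open>z \<in> \<omega>\<close>.  That transform is holomorphic off the closed sector and
  vanishes at infinity.  As \<open>\<omega>\<close> misses an arc, it continues \<open>f\<^sub>0\<close> along a ray through that arc, so
  beyond the unit circle it agrees with the extension of \<open>f\<^sub>0\<close> to the larger disk.  Together they
  form an entire function that vanishes at infinity, which is \<open>0\<close> by Liouville's theorem.\<close>

section \<open>Fourier series in \<open>L2T\<close>\<close>

lemma fourier_coeff_abs_L2T:
  "square_integrable circle_measure f \<Longrightarrow>
    fourier_coeff (abs_L2T f) n = (LINT z|circle_measure. f z * z powi (- n))"
  by (subst fourier_coeff.abs_eq) auto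

lemma borel_measurable_powi [measurable]: "(\<lambda>z::complex. z powi k) \<in> borel_measurable borel"
  using square_integrable_powi[of k] unfolding square_integrable_def
  by (simp cong: measurable_cong_sets)

text \<open>The inner product is the real part of the complex one, and on the circle the conjugate
  of \<open>z powi n\<close> is \<open>z powi (- n)\<close>. The free factor \<open>c\<close> makes
  the whole complex coefficient accessible.\<close>

lemma inner_scaleC_monomial_L2T:
  "inner x (scaleC_L2T c (monomial_L2T n)) = Re (cnj c * fourier_coeff x n)"
proof (cases x rule: abs_L2T_cases)
  case (1 f)
  have [measurable]: "f \<in> borel_measurable borel" using 1 by (auto simp: square_integrable_def)
  have "inner x (scaleC_L2T c (monomial_L2T n)) =
      Re (LINT z|circle_measure. f z * cnj (c * z powi n))"
    unfolding 1(2) monomial_L2T.abs_eq scaleC_L2T_abs[OF square_integrable_powi]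
    using 1(1) by (subst inner_L2T.abs_eq) (auto intro: square_integrable_cmult square_integrable_powi)
  also have "(LINT z|circle_measure. f z * cnj (c * z powi n)) =
      (LINT z|circle_measure. cnj c * (f z * z powi (- n)))"
  proof (rule integral_cong_AE)
    show "AE z in circle_measure. f z * cnj (c * z powi n) = cnj c * (f z * z powi (- n))"
      using AE_circle_norm
    proof eventually_elim
      case (elim z)
      then have "cnj z = inverse z" by (simp add: inverse_eq_divide divide_conv_cnj)
      then have "cnj (z powi n) = z powi (- n)"
        by (simp add: power_int_inverse power_int_minus)
      then show ?case by (simp add: mult_ac)
    qed
  qed measurable
  also have "\<dots> = cnj c * fourier_coeff x n"
    unfolding 1(2) by (simp add: fourier_coeff_abs_L2T 1(1))
  finally show ?thesis .
qed

text \<open>Testing against the monomial with \<open>c = 1\<close> and \<open>c = \<i>\<close> gives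
  the real and the imaginary part. Continuity lets coefficients pass through infinite sums and
  Bochner integrals.\<close>

lemma bounded_linear_fourier_coeff: "bounded_linear (\<lambda>x. fourier_coeff x n)"
proof -
  have eq: "fourier_coeff x n = of_real (inner x (scaleC_L2T 1 (monomial_L2T n))) +
      \<i> * of_real (inner x (scaleC_L2T \<i> (monomial_L2T n)))" for x
    by (simp add: inner_scaleC_monomial_L2T complex_eq_iff)
  show ?thesis unfolding eq
    by (intro bounded_linear_add bounded_linear_const_mult
        bounded_linear_compose[OF bounded_linear_of_real] bounded_linear_inner_left)
qed

lemma fourier_coeff_sum_monomials:
  "finite F \<Longrightarrow> fourier_coeff (\<Sum>n\<in>F. scaleC_L2T (c n) (monomial_L2T n)) k = (if k \<in> F then c k else 0)"
  by (simp add: linear_sum[OF bounded_linear.linear[OF bounded_linear_fourier_coeff]] fourier_coeff_monomial)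

text \<open>Pythagoras: the monomials are orthonormal.\<close>

lemma norm_sum_monomials:
  assumes "finite F"
  shows "(norm (\<Sum>n\<in>F. scaleC_L2T (c n) (monomial_L2T n)))\<^sup>2 = (\<Sum>n\<in>F. (cmod (c n))\<^sup>2)"
proof -
  let ?s = "\<Sum>n\<in>F. scaleC_L2T (c n) (monomial_L2T n)"
  have "inner ?s ?s = (\<Sum>n\<in>F. (cmod (c n))\<^sup>2)"
    unfolding inner_sum_right inner_scaleC_monomial_L2T using assms
    by (intro sum.cong) (auto simp: fourier_coeff_sum_monomials mult.commute[of "cnj _"] simp flip: complex_norm_square)
  then show ?thesis by (simp only: power2_norm_eq_inner)
qed

text \<open>For the partial sum \<open>?s\<close>, both \<open>inner x ?s\<close> and the squared
  norm of \<open>?s\<close> equal the left-hand side, so expanding the squared norm of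
  \<open>x - ?s\<close>, which is nonnegative, gives the bound.\<close>

lemma bessel_inequality:
  assumes "finite F"
  shows "(\<Sum>n\<in>F. (cmod (fourier_coeff x n))\<^sup>2) \<le> (norm x)\<^sup>2"
proof -
  let ?s = "\<Sum>n\<in>F. scaleC_L2T (fourier_coeff x n) (monomial_L2T n)"
  have "inner x ?s = (\<Sum>n\<in>F. (cmod (fourier_coeff x n))\<^sup>2)"
    unfolding inner_sum_right inner_scaleC_monomial_L2T
    by (intro sum.cong) (auto simp: mult.commute[of "cnj _"] simp flip: complex_norm_square)
  moreover have "0 \<le> (norm (x - ?s))\<^sup>2" by simp
  ultimately show ?thesis
    using norm_sum_monomials[OF assms, of "fourier_coeff x"]
    by (simp add: power2_norm_eq_inner inner_diff inner_commute)
qed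

text \<open>Riesz-Fischer: by Pythagoras the finite partial sums form a Cauchy net, which converges
  because \<open>L2T\<close> is complete. Square summable coefficients need not give absolute
  convergence, so the Cauchy filter is treated directly.\<close>

lemma summable_on_monomials:
  assumes c: "(\<lambda>n. (cmod (c n))\<^sup>2) summable_on A"
  shows "(\<lambda>n. scaleC_L2T (c n) (monomial_L2T n)) summable_on A"
proof -
  let ?f = "\<lambda>n. scaleC_L2T (c n) (monomial_L2T n)" and ?g = "\<lambda>n. (cmod (c n))\<^sup>2"
  have "\<exists>P. eventually P (finite_subsets_at_top A) \<and>
      (\<forall>F F'. P F \<and> P F' \<longrightarrow> dist (sum ?f F) (sum ?f F') < e)" if e: "e > 0" for e
  proof -
    \<comment> \<open>The tail is measured in squared norm. The extra factor 1/2 turns the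
      non-strict approximation into a strict distance below \<open>e/2\<close>.\<close>
    obtain F\<^sub>0 where F\<^sub>0: "finite F\<^sub>0" "F\<^sub>0 \<subseteq> A" "dist (sum ?g F\<^sub>0) (infsum ?g A) \<le> (e/2)\<^sup>2 / 2"
      using infsum_finite_approximation[OF c, of "(e/2)\<^sup>2 / 2"] e by auto
    define P where "P F \<longleftrightarrow> finite F \<and> F\<^sub>0 \<subseteq> F \<and> F \<subseteq> A" for F
    \<comment> \<open>Pythagoras evaluates the distance for nested sets, so two arbitrary sets
      \<open>F\<close> and \<open>F'\<close> are compared through the common subset
      \<open>F\<^sub>0\<close>.\<close>
    have near: "dist (sum ?f F) (sum ?f F\<^sub>0) < e / 2" if "P F" for F
    proof -
      have F: "finite F" "F\<^sub>0 \<subseteq> F" "F \<subseteq> A" using that by (auto simp: P_def)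
      have "(dist (sum ?f F) (sum ?f F\<^sub>0))\<^sup>2 = sum ?g (F - F\<^sub>0)"
        using F by (simp add: dist_norm norm_sum_monomials flip: sum_diff)
      also have "\<dots> = sum ?g F - sum ?g F\<^sub>0" using F by (simp add: sum_diff)
      also have "\<dots> \<le> infsum ?g A - sum ?g F\<^sub>0"
        using finite_sum_le_infsum[OF c F(1,3)] by simp
      also have "\<dots> \<le> (e/2)\<^sup>2 / 2" using F\<^sub>0(3) unfolding dist_real_def by linarith
      also have "\<dots> < (e/2)\<^sup>2" using e by simp
      finally show ?thesis using e by (intro power2_less_imp_less[of _ "e/2"]) auto
    qed
    have "dist (sum ?f F) (sum ?f F') < e" if "P F" "P F'" for F F'
      using near[OF that(1)] near[OF that(2)] dist_triangle2[of "sum ?f F" "sum ?f F'" "sum ?f F\<^sub>0"]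
      by linarith
    moreover have "eventually P (finite_subsets_at_top A)"
      unfolding P_def eventually_finite_subsets_at_top using F\<^sub>0 by blast
    ultimately show ?thesis by blast
  qed
  then have "cauchy_filter (filtermap (sum ?f) (finite_subsets_at_top A))"
    by (simp add: cauchy_filter_metric_filtermap)
  moreover have "complete (UNIV :: L2T set)"
    by (meson Cauchy_convergent UNIV_I complete_def convergent_def)
  ultimately obtain L where "(sum ?f \<longlongrightarrow> L) (finite_subsets_at_top A)"
    using complete_uniform[where S="UNIV :: L2T set"] by (force simp add: filterlim_def)
  then show ?thesis
    using summable_on_def has_sum_def by blast
qed

lemma fourier_coeff_infsum_monomials:
  assumes "(\<lambda>n. scaleC_L2T (c n) (monomial_L2T n)) summable_on A"
  shows "fourier_coeff (\<Sum>\<^sub>\<infinity>n\<in>A. scaleC_L2T (c n) (monomial_L2T n)) k = (if k \<in> A then c k else 0)"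
proof -
  have "((\<lambda>n. fourier_coeff (scaleC_L2T (c n) (monomial_L2T n)) k) has_sum
      fourier_coeff (\<Sum>\<^sub>\<infinity>n\<in>A. scaleC_L2T (c n) (monomial_L2T n)) k) A"
    using has_sum_bounded_linear[OF bounded_linear_fourier_coeff has_sum_infsum[OF assms]] .
  moreover have "((\<lambda>n. fourier_coeff (scaleC_L2T (c n) (monomial_L2T n)) k) has_sum
      (\<Sum>n\<in>A \<inter> {k}. c n)) A"
    by (rule has_sum_finite_neutralI[where B="A \<inter> {k}"]) (auto simp: fourier_coeff_monomial)
  ultimately have "fourier_coeff (\<Sum>\<^sub>\<infinity>n\<in>A. scaleC_L2T (c n) (monomial_L2T n)) k = (\<Sum>n\<in>A \<inter> {k}. c n)"
    by (rule has_sum_unique)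
  then show ?thesis by (cases "k \<in> A") auto
qed

text \<open>Bessel bounds every finite sum of squares. This covers the series of both
  \<open>riesz_projector\<close> and \<open>semigroup_S\<close>, and ensures that their
  \<open>infsum\<close> is a true sum and not the default value 0.\<close>

lemma summable_on_fourier_coeff:
  assumes "\<And>n. cmod (c n) \<le> cmod (fourier_coeff x n)"
  shows "(\<lambda>n. scaleC_L2T (c n) (monomial_L2T n)) summable_on A"
proof (rule summable_on_monomials, rule nonneg_bdd_above_summable_on)
  show "bdd_above (sum (\<lambda>n. (cmod (c n))\<^sup>2) ` {F. F \<subseteq> A \<and> finite F})"
  proof (rule bdd_aboveI)
    fix y assume "y \<in> sum (\<lambda>n. (cmod (c n))\<^sup>2) ` {F. F \<subseteq> A \<and> finite F}"
    then obtain F where F: "finite F" "y = (\<Sum>n\<in>F. (cmod (c n))\<^sup>2)" by auto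
    have "y \<le> (\<Sum>n\<in>F. (cmod (fourier_coeff x n))\<^sup>2)"
      unfolding F by (intro sum_mono power_mono assms) auto
    also have "\<dots> \<le> (norm x)\<^sup>2" by (rule bessel_inequality) fact
    finally show "y \<le> (norm x)\<^sup>2" .
  qed
qed simp

section \<open>Fourier coefficients of the Riesz projector and the semigroup\<close>

lemma fourier_coeff_riesz_projector:
  "fourier_coeff (riesz_projector x) n = (if n \<ge> 0 then fourier_coeff x n else 0)"
  unfolding riesz_projector_def
  by (simp add: fourier_coeff_infsum_monomials[OF summable_on_fourier_coeff[OF order_refl]])

text \<open>For \<open>t \<ge> 0\<close> the multiplier is at most 1, so the damped coefficients are
  dominated by those of \<open>x\<close>.\<close>

lemma fourier_coeff_semigroup_S:
  assumes "t \<ge> 0"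
  shows "fourier_coeff (semigroup_S t x) n = fourier_coeff x n * of_real (exp (- \<bar>of_int n\<bar> * t))"
proof -
  have "cmod (fourier_coeff x n * of_real (exp (- \<bar>of_int n\<bar> * t))) \<le> cmod (fourier_coeff x n)" for n
    using assms by (simp add: norm_mult mult_left_le)
  then show ?thesis
    unfolding semigroup_S_def
    by (subst fourier_coeff_infsum_monomials[OF summable_on_fourier_coeff]) auto
qed

text \<open>Write \<open>x\<close> as the projection of some \<open>y\<close>. The coefficients of
  \<open>x\<close> at nonnegative indices are those of \<open>y\<close>, and they are exactly the
  ones in the sum that defines the projection.\<close>

lemma H2_eq_0I:
  assumes "x \<in> H2" and "\<And>n::nat. fourier_coeff x (int n) = 0"
  shows "x = 0"
proof -
  obtain y where y: "x = riesz_projector y" using assms(1) by (auto simp: H2_def)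
  have "fourier_coeff y n = 0" if "n \<ge> 0" for n
    using assms(2)[of "nat n"] that by (simp add: y fourier_coeff_riesz_projector)
  then have "riesz_projector y = (\<Sum>\<^sub>\<infinity>n\<in>{0::int..}. 0)"
    unfolding riesz_projector_def by (intro infsum_cong) auto
  then show ?thesis by (simp add: y)
qed

text \<open>Bessel with a single term bounds every coefficient by \<open>norm x\<close>, which
  leaves a geometric series.\<close>

lemma summable_fourier_coeff_power:
  assumes "cmod z < 1"
  shows "summable (\<lambda>n. fourier_coeff x (int n) * z ^ n)"
proof (rule summable_comparison_test')
  show "summable (\<lambda>n. norm x * cmod z ^ n)"
    using assms by (intro summable_mult summable_geometric) auto
  show "norm (fourier_coeff x (int n) * z ^ n) \<le> norm x * cmod z ^ n" for n
  proof -
    have "(cmod (fourier_coeff x (int n)))\<^sup>2 \<le> (norm x)\<^sup>2"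
      using bessel_inequality[of "{int n}" x] by simp
    then have "cmod (fourier_coeff x (int n)) \<le> norm x" by (rule power2_le_imp_le) simp
    then show ?thesis by (auto simp: norm_mult norm_power intro!: mult_right_mono)
  qed
qed

section \<open>Cauchy transforms\<close>

lemma integrable_cauchy_kernel:
  fixes v p :: "'a \<Rightarrow> complex"
  assumes v: "integrable M v" and [measurable]: "p \<in> borel_measurable M"
    and d: "d > 0" "\<And>x. x \<in> space M \<Longrightarrow> d \<le> cmod (p x - w)"
  shows "integrable M (\<lambda>x. v x / (p x - w))"
proof (rule Bochner_Integration.integrable_bound)
  have [measurable]: "v \<in> borel_measurable M" using v by simp
  show "integrable M (\<lambda>x. v x / of_real d)" using v by simp
  show "(\<lambda>x. v x / (p x - w)) \<in> borel_measurable M" by measurable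
  show "AE x in M. norm (v x / (p x - w)) \<le> norm (v x / of_real d)"
    using d by (intro AE_I2) (auto simp: norm_divide intro!: divide_left_mono mult_pos_pos intro: less_le_trans)
qed

text \<open>Differentiation under the integral sign: the difference quotients are again integrals of
  kernels, and dominated convergence applies because \<open>\<zeta>\<close> has positive distance
  from \<open>C\<close>.\<close>

lemma cauchy_transform_holomorphic:
  fixes v p :: "'a \<Rightarrow> complex"
  assumes v: "integrable M v" and p [measurable]: "p \<in> borel_measurable M"
    and C: "closed C" "\<And>x. x \<in> space M \<Longrightarrow> p x \<in> C"
  shows "(\<lambda>\<zeta>. LINT x|M. v x / (p x - \<zeta>)) holomorphic_on - C"
proof -
  let ?F = "\<lambda>\<zeta>. LINT x|M. v x / (p x - \<zeta>)"
  have "\<exists>D. (?F has_field_derivative D) (at \<zeta>)" if \<zeta>: "\<zeta> \<in> - C" for \<zeta>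
  proof -
    have [measurable]: "v \<in> borel_measurable M" using v by simp
    obtain e where e: "e > 0" "ball \<zeta> e \<subseteq> - C"
      using \<zeta> C(1) open_contains_ball[of "- C"] by (auto simp: open_Compl)
    \<comment> \<open>With half the radius, every \<open>w\<close> in the smaller ball keeps
      distance at least \<open>d\<close> from all values of \<open>p\<close>; this gives a uniform
      bound on the kernel.\<close>
    define d where "d = e / 2"
    have d: "d > 0" using e by (simp add: d_def)
    have far: "d \<le> cmod (p x - w)" if x: "x \<in> space M" and w: "w \<in> ball \<zeta> d" for x w
    proof -
      have "p x \<notin> ball \<zeta> e" using C(2)[OF x] e(2) by blast
      then have "e \<le> cmod (p x - \<zeta>)" by (simp add: dist_norm norm_minus_commute)
      also have "\<dots> \<le> cmod (p x - w) + cmod (w - \<zeta>)"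
        using norm_triangle_ineq[of "p x - w" "w - \<zeta>"] by simp
      finally show ?thesis using w by (simp add: d_def dist_norm norm_minus_commute)
    qed
    have \<zeta>d: "\<zeta> \<in> ball \<zeta> d" using d by simp
    have int: "integrable M (\<lambda>x. v x / (p x - w))" if "w \<in> ball \<zeta> d" for w
      by (rule integrable_cauchy_kernel[OF v p d far[OF _ that]])
    have "(?F has_field_derivative (LINT x|M. v x / (p x - \<zeta>) / (p x - \<zeta>))) (at \<zeta> within ball \<zeta> d)"
      unfolding has_field_derivative_iff tendsto_at_iff_sequentially
    proof (intro allI impI)
      fix X :: "nat \<Rightarrow> complex"
      assume X: "\<forall>i. X i \<in> ball \<zeta> d - {\<zeta>}" and lim: "X \<longlonglongrightarrow> \<zeta>"
      have quot: "(?F (X i) - ?F \<zeta>) / (X i - \<zeta>) = (LINT x|M. v x / (p x - \<zeta>) / (p x - X i))" for i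
      proof -
        have Xi: "X i \<in> ball \<zeta> d" "X i \<noteq> \<zeta>" using X by auto
        have "(?F (X i) - ?F \<zeta>) / (X i - \<zeta>) =
            (LINT x|M. (v x / (p x - X i) - v x / (p x - \<zeta>)) / (X i - \<zeta>))"
          using int[OF Xi(1)] int[OF \<zeta>d] by simp
        also have "\<dots> = (LINT x|M. v x / (p x - \<zeta>) / (p x - X i))"
        proof (rule Bochner_Integration.integral_cong[OF refl])
          fix x assume x: "x \<in> space M"
          have "p x - X i \<noteq> 0" "p x - \<zeta> \<noteq> 0" "X i - \<zeta> \<noteq> 0"
            using far[OF x Xi(1)] far[OF x \<zeta>d] d Xi by auto
          then show "(v x / (p x - X i) - v x / (p x - \<zeta>)) / (X i - \<zeta>) = v x / (p x - \<zeta>) / (p x - X i)"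
            by (simp add: divide_simps) (simp add: algebra_simps)
        qed
        finally show ?thesis .
      qed
      have "(\<lambda>i. LINT x|M. v x / (p x - \<zeta>) / (p x - X i)) \<longlonglongrightarrow>
          (LINT x|M. v x / (p x - \<zeta>) / (p x - \<zeta>))"
      proof (rule integral_dominated_convergence[where w="\<lambda>x. cmod (v x / (p x - \<zeta>)) / d"])
        show "AE x in M. (\<lambda>i. v x / (p x - \<zeta>) / (p x - X i)) \<longlonglongrightarrow> v x / (p x - \<zeta>) / (p x - \<zeta>)"
        proof (rule AE_I2)
          fix x assume "x \<in> space M"
          then have "p x - \<zeta> \<noteq> 0" using far[OF _ \<zeta>d] d by force
          then show "(\<lambda>i. v x / (p x - \<zeta>) / (p x - X i)) \<longlonglongrightarrow> v x / (p x - \<zeta>) / (p x - \<zeta>)"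
            by (intro tendsto_intros lim) auto
        qed
        show "AE x in M. norm (v x / (p x - \<zeta>) / (p x - X i)) \<le> cmod (v x / (p x - \<zeta>)) / d" for i
          unfolding norm_divide[of "v _ / _"]
        proof (intro AE_I2 divide_left_mono)
          fix x assume "x \<in> space M"
          then have "d \<le> cmod (p x - X i)" using X by (intro far) auto
          then show "d \<le> cmod (p x - X i)" "0 < cmod (p x - X i) * d" using d by (auto intro!: mult_pos_pos)
        qed auto
        show "integrable M (\<lambda>x. cmod (v x / (p x - \<zeta>)) / d)"
          using int[OF \<zeta>d] by simp
      qed measurable
      then show "((\<lambda>y. (?F y - ?F \<zeta>) / (y - \<zeta>)) \<circ> X) \<longlonglongrightarrow>
          (LINT x|M. v x / (p x - \<zeta>) / (p x - \<zeta>))"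
        by (simp add: o_def quot)
    qed
    then show ?thesis
      using d by (auto simp: at_within_open[OF \<zeta>d open_ball])
  qed
  then show ?thesis
    using C(1) by (auto simp: holomorphic_on_open open_Compl)
qed

text \<open>For \<open>\<zeta>\<close> outside the disk of radius \<open>R\<close> the kernel is
  bounded by the reciprocal of \<open>cmod \<zeta> - R\<close>.\<close>

lemma cauchy_transform_tendsto_0:
  fixes v p :: "'a \<Rightarrow> complex"
  assumes v: "integrable M v" and p [measurable]: "p \<in> borel_measurable M"
    and R: "\<And>x. x \<in> space M \<Longrightarrow> cmod (p x) \<le> R"
  shows "((\<lambda>\<zeta>. LINT x|M. v x / (p x - \<zeta>)) \<longlongrightarrow> 0) at_infinity"
proof (rule tendsto_0_le[where K=1])
  let ?I = "LINT x|M. cmod (v x)"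
  show "((\<lambda>\<zeta>. ?I / (cmod \<zeta> - R)) \<longlongrightarrow> 0) at_infinity"
    unfolding diff_conv_add_uminus add.commute[of _ "- R"]
    by (intro tendsto_divide_0[OF tendsto_const] filterlim_at_top_imp_at_infinity
        filterlim_tendsto_add_at_top[OF tendsto_const] filterlim_norm_at_top)
  show "\<forall>\<^sub>F \<zeta> in at_infinity. norm (LINT x|M. v x / (p x - \<zeta>)) \<le> norm (?I / (cmod \<zeta> - R)) * 1"
    unfolding eventually_at_infinity
  proof (intro exI allI impI)
    fix \<zeta> :: complex assume \<zeta>: "R + 1 \<le> cmod \<zeta>"
    have far: "cmod \<zeta> - R \<le> cmod (p x - \<zeta>)" if "x \<in> space M" for x
      using R[OF that] norm_triangle_ineq2[of \<zeta> "p x"] by (simp add: norm_minus_commute)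
    have "norm (LINT x|M. v x / (p x - \<zeta>)) \<le> (LINT x|M. cmod (v x / (p x - \<zeta>)))"
      by (rule integral_norm_bound)
    also have "\<dots> \<le> (LINT x|M. cmod (v x) / (cmod \<zeta> - R))"
    proof (rule integral_mono)
      show "integrable M (\<lambda>x. cmod (v x / (p x - \<zeta>)))"
        using integrable_cauchy_kernel[OF v p _ far] \<zeta> by simp
      show "cmod (v x / (p x - \<zeta>)) \<le> cmod (v x) / (cmod \<zeta> - R)" if "x \<in> space M" for x
        using far[OF that] \<zeta>
        by (auto simp: norm_divide intro!: divide_left_mono mult_pos_pos intro: less_le_trans)
    qed (use v in simp)
    finally show "norm (LINT x|M. v x / (p x - \<zeta>)) \<le> norm (?I / (cmod \<zeta> - R)) * 1"
      using \<zeta> by simp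
  qed
qed

text \<open>Expand \<open>p x / (p x - \<zeta>)\<close> as a geometric series in
  \<open>\<zeta> / p x\<close> and integrate termwise. This identifies the moments of
  \<open>u\<close> as the Taylor coefficients at 0 of the Cauchy transform with density
  \<open>u x * p x\<close>.\<close>

lemma cauchy_transform_sums:
  fixes u p :: "'a \<Rightarrow> complex"
  assumes u: "integrable M u" and p [measurable]: "p \<in> borel_measurable M"
    and \<delta>: "\<And>x. x \<in> space M \<Longrightarrow> \<delta> \<le> cmod (p x)" and \<zeta>: "cmod \<zeta> < \<delta>"
  shows "(\<lambda>n. (LINT x|M. u x / p x ^ n) * \<zeta> ^ n) sums (LINT x|M. u x * p x / (p x - \<zeta>))"
proof -
  have [measurable]: "u \<in> borel_measurable M" using u by simp
  have \<delta>0: "\<delta> > 0" using \<zeta> norm_ge_zero[of \<zeta>] by linarith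
  \<comment> \<open>A ratio below 1 that dominates \<open>\<zeta> / p x\<close> uniformly in
    \<open>x\<close>.\<close>
  define q where "q = cmod \<zeta> / \<delta>"
  have q: "0 \<le> q" "q < 1" using \<zeta> \<delta>0 by (auto simp: q_def)
  have ratio: "cmod (\<zeta> / p x) \<le> q" if "x \<in> space M" for x
    using \<delta>[OF that] \<delta>0 unfolding q_def norm_divide by (intro divide_left_mono mult_pos_pos) auto
  have bound: "cmod (u x * (\<zeta> / p x) ^ n) \<le> cmod (u x) * q ^ n" if "x \<in> space M" for x n
    using ratio[OF that] by (auto simp: norm_mult norm_power intro!: mult_left_mono power_mono)
  have int: "integrable M (\<lambda>x. u x * (\<zeta> / p x) ^ n)" for n
  proof (rule Bochner_Integration.integrable_bound[where f="\<lambda>x. u x * of_real (q ^ n)"])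
    show "AE x in M. norm (u x * (\<zeta> / p x) ^ n) \<le> norm (u x * of_real (q ^ n))"
      using bound q by (auto simp: norm_mult norm_power)
  qed (use u in auto)
  have summ: "summable (\<lambda>n. c * q ^ n)" for c :: real
    using q by (intro summable_mult summable_geometric) auto
  have "(\<lambda>n. LINT x|M. u x * (\<zeta> / p x) ^ n) sums (LINT x|M. (\<Sum>n. u x * (\<zeta> / p x) ^ n))"
  proof (rule sums_integral[OF int])
    show "AE x in M. summable (\<lambda>n. norm (u x * (\<zeta> / p x) ^ n))"
      using bound by (intro AE_I2 summable_comparison_test'[OF summ]) auto
    show "summable (\<lambda>n. LINT x|M. norm (u x * (\<zeta> / p x) ^ n))"
    proof (rule summable_comparison_test'[OF summ])
      fix n :: nat
      have "(LINT x|M. norm (u x * (\<zeta> / p x) ^ n)) \<le> (LINT x|M. cmod (u x) * q ^ n)"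
        using int u bound by (intro integral_mono) auto
      then show "norm (LINT x|M. norm (u x * (\<zeta> / p x) ^ n)) \<le> (LINT x|M. cmod (u x)) * q ^ n"
        by simp
    qed
  qed
  also have "(LINT x|M. (\<Sum>n. u x * (\<zeta> / p x) ^ n)) = (LINT x|M. u x * p x / (p x - \<zeta>))"
  proof (rule Bochner_Integration.integral_cong[OF refl])
    fix x assume x: "x \<in> space M"
    then have "cmod (\<zeta> / p x) < 1" using ratio q by force
    then have "(\<Sum>n. u x * (\<zeta> / p x) ^ n) = u x * (1 / (1 - \<zeta> / p x))"
      by (subst suminf_mult) (auto simp: suminf_geometric)
    also have "\<dots> = u x * p x / (p x - \<zeta>)"
      using \<delta>[OF x] \<delta>0 by (auto simp: divide_simps)
    finally show "(\<Sum>n. u x * (\<zeta> / p x) ^ n) = u x * p x / (p x - \<zeta>)" .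
  qed
  also have "(\<lambda>n. LINT x|M. u x * (\<zeta> / p x) ^ n) = (\<lambda>n. (LINT x|M. u x / p x ^ n) * \<zeta> ^ n)"
  proof
    fix n
    have "(\<lambda>x. u x * (\<zeta> / p x) ^ n) = (\<lambda>x. u x / p x ^ n * \<zeta> ^ n)"
      by (auto simp: power_divide)
    then show "(LINT x|M. u x * (\<zeta> / p x) ^ n) = (LINT x|M. u x / p x ^ n) * \<zeta> ^ n"
      by (simp only: integral_mult_left_zero)
  qed
  finally show ?thesis .
qed

section \<open>Continuation around an annular sector\<close>

text \<open>A polar rectangle. As the image of a product under a continuous map it inherits
  compactness from \<open>A\<close>.\<close>

definition annular_sector :: "real \<Rightarrow> complex set \<Rightarrow> complex set" where
  "annular_sector \<delta> A = (\<lambda>(\<rho>, z). of_real \<rho> * z) ` ({\<delta>..1} \<times> A)"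

lemma compact_annular_sector: "compact A \<Longrightarrow> compact (annular_sector \<delta> A)"
  unfolding annular_sector_def
  by (intro compact_continuous_image compact_Times) (auto simp: case_prod_unfold intro!: continuous_intros)

lemma cmod_annular_sector:
  assumes "w \<in> annular_sector \<delta> A" "A \<subseteq> sphere 0 1" "\<delta> > 0"
  shows "cmod w \<in> {\<delta>..1}"
  using assms by (auto simp: annular_sector_def norm_mult)

text \<open>The complement of the sector stays connected inside a larger disk because of the ray
  through \<open>z\<^sub>0\<close>, so the two functions continue each other past the unit circle.\<close>

lemma eq_beyond_annular_sector:
  assumes f: "f holomorphic_on ball 0 r" and g: "g holomorphic_on - annular_sector \<delta> A"
    and A: "compact A" "A \<subseteq> sphere 0 1" and z\<^sub>0: "z\<^sub>0 \<in> sphere 0 1 - A" and \<delta>: "0 < \<delta>"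
    and eq: "\<And>z. cmod z < \<delta> \<Longrightarrow> f z = g z"
    and w: "1 < cmod w" "cmod w < r"
  shows "f w = g w"
proof -
  let ?C = "annular_sector \<delta> A"
  define U where "U = ball 0 r - ?C"
  define S where "S = connected_component_set U 0"
  have "closed ?C" using A compact_annular_sector compact_imp_closed by blast
  then have "open U" unfolding U_def by (intro open_Diff) auto
  have sector: "cmod z \<in> {\<delta>..1}" if "z \<in> ?C" for z
    using cmod_annular_sector[OF that A(2) \<delta>] .
  have "cmod 0 < r" using w by simp
  then have 0: "0 \<in> U" unfolding U_def using sector[of 0] \<delta> by auto
  have "open S" "connected S" "S \<subseteq> U"
    using \<open>open U\<close> by (auto simp: S_def open_connected_component connected_component_subset)
  \<comment> \<open>On this ball \<open>f\<close> and \<open>g\<close> agree by assumption, and it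
    lies in \<open>U\<close> because the sector has no point of modulus below
    \<open>\<delta>\<close>. It is the starting set for the identity theorem on the component
    \<open>S\<close>.\<close>
  have small: "ball 0 (min r \<delta>) \<subseteq> S"
    unfolding S_def
    by (rule connected_component_maximal) (use w \<delta> sector in \<open>force simp: U_def\<close>)+
  have "w \<in> S"
  proof -
    \<comment> \<open>A connected set joining 0 to \<open>w\<close> inside \<open>U\<close>: first
      along the ray through \<open>z\<^sub>0\<close> out to modulus \<open>cmod w\<close>, then
      within the annulus of moduli from \<open>cmod w\<close> to \<open>r\<close>, which lies beyond
      the sector since \<open>cmod w > 1\<close>.\<close>
    define K where "K = closed_segment 0 (of_real (cmod w) * z\<^sub>0) \<union> (ball 0 r - ball 0 (cmod w))"
    have end_point: "of_real (cmod w) * z\<^sub>0 \<in> ball 0 r - ball 0 (cmod w)"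
      using z\<^sub>0 w by (simp add: norm_mult)
    \<comment> \<open>Comparing moduli forces \<open>t = \<rho> > 0\<close>, hence
      \<open>z\<^sub>0 = z\<close>, which would lie in \<open>A\<close>.\<close>
    have ray: "of_real t * z\<^sub>0 \<notin> ?C" if "t \<ge> 0" for t
    proof
      assume "of_real t * z\<^sub>0 \<in> ?C"
      then obtain \<rho> z where \<rho>: "\<delta> \<le> \<rho>" "z \<in> A" "of_real t * z\<^sub>0 = of_real \<rho> * z"
        by (auto simp: annular_sector_def)
      then have "cmod (of_real t * z\<^sub>0) = cmod (of_real \<rho> * z)" by simp
      moreover have "cmod z = 1" "cmod z\<^sub>0 = 1" using \<rho>(2) A(2) z\<^sub>0 by auto
      ultimately have "t = \<rho>" using \<rho>(1) \<delta> that by (simp add: norm_mult)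
      then show False using \<rho> \<delta> z\<^sub>0 by auto
    qed
    have "connected (ball 0 r - ball (0 :: complex) (cmod w))"
      by (rule connected_diff_ball) (use w in \<open>auto simp: DIM_complex\<close>)
    then have "connected K"
      unfolding K_def using end_point by (intro connected_Un) auto
    moreover have "K \<subseteq> U"
    proof
      fix z assume "z \<in> K"
      then consider t where "0 \<le> t" "t \<le> 1" "z = of_real (t * cmod w) * z\<^sub>0"
        | "cmod z < r" "cmod w \<le> cmod z"
        unfolding K_def by (auto simp: in_segment scaleR_conv_of_real mult.assoc[symmetric])
      then show "z \<in> U"
      proof cases
        case 1
        have "t * cmod w \<le> 1 * cmod w" using 1 by (intro mult_right_mono) auto
        then show ?thesis
          using 1 w z\<^sub>0 ray[of "t * cmod w"] by (simp add: U_def norm_mult)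
      next
        case 2
        then show ?thesis using sector[of z] w by (auto simp: U_def)
      qed
    qed
    moreover have "0 \<in> K" "w \<in> K" using w by (auto simp: K_def)
    ultimately show ?thesis
      unfolding S_def using connected_component_maximal by blast
  qed
  show ?thesis
  proof (rule analytic_continuation_open[OF open_ball \<open>open S\<close> _ \<open>connected S\<close> small _ _ _ \<open>w \<in> S\<close>])
    show "ball 0 (min r \<delta>) \<noteq> ({} :: complex set)" using \<delta> w by auto
    show "f holomorphic_on S" using f \<open>S \<subseteq> U\<close> by (auto simp: U_def intro: holomorphic_on_subset)
    show "g holomorphic_on S" using g \<open>S \<subseteq> U\<close> by (auto simp: U_def intro: holomorphic_on_subset)
  qed (auto simp: eq)
qed

text \<open>Since \<open>r > 1\<close>, the disk of radius \<open>r\<close> and the exterior of the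
  closed unit disk cover the plane. The functions agree on the overlap, so they glue to an entire
  function tending to 0 at infinity, and Liouville applies.\<close>

lemma eq_0_if_continues_off_annular_sector:
  assumes f: "f holomorphic_on ball 0 r" and r: "r > 1"
    and g: "g holomorphic_on - annular_sector \<delta> A" "(g \<longlongrightarrow> 0) at_infinity"
    and A: "compact A" "A \<subseteq> sphere 0 1" "A \<noteq> sphere 0 1" and \<delta>: "0 < \<delta>"
    and eq: "\<And>z. cmod z < \<delta> \<Longrightarrow> f z = g z"
    and w: "cmod w < r"
  shows "f w = 0"
proof -
  obtain z\<^sub>0 where z\<^sub>0: "z\<^sub>0 \<in> sphere 0 1 - A" using A by blast
  define h where "h z = (if z \<in> ball 0 r then f z else g z)" for z
  have "h holomorphic_on ball 0 r \<union> - cball 0 1"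
    unfolding h_def
  proof (rule holomorphic_on_If_Un[OF f])
    show "g holomorphic_on - cball 0 1"
      by (rule holomorphic_on_subset[OF g(1)]) (use cmod_annular_sector[OF _ A(2) \<delta>] in force)
    show "f z = g z" if "z \<in> ball 0 r" "z \<in> - cball 0 1" for z
      using that by (intro eq_beyond_annular_sector[OF f g(1) A(1,2) z\<^sub>0 \<delta> eq]) auto
  qed auto
  moreover have "ball 0 r \<union> - cball 0 1 = (UNIV :: complex set)" using r by force
  moreover have "(h \<longlongrightarrow> 0) at_infinity"
  proof (rule tendsto_cong[THEN iffD1, OF _ g(2)])
    show "\<forall>\<^sub>F z in at_infinity. g z = h z"
      unfolding eventually_at_infinity h_def by (intro exI[of _ r]) auto
  qed
  ultimately have "h w = 0" using Liouville_weak by simp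
  then show ?thesis using w by (simp add: h_def)
qed

text \<open>The formal power series with coefficients \<open>a\<close> has positive radius of
  convergence and vanishes near 0, so it is the zero series.\<close>

lemma powser_eq_0_imp_coeffs_eq_0:
  fixes a :: "nat \<Rightarrow> complex"
  assumes "\<delta> > 0" "\<And>z. cmod z < \<delta> \<Longrightarrow> (\<lambda>n. a n * z ^ n) sums 0"
  shows "a n = 0"
proof -
  have "conv_radius a \<ge> ereal \<delta>"
  proof (rule conv_radius_geI_ex)
    fix t :: real assume t: "0 < t" "ereal t < ereal \<delta>"
    show "\<exists>z. cmod z = t \<and> summable (\<lambda>n. a n * z ^ n)"
      using t sums_summable[OF assms(2)[of "of_real t"]] by (intro exI[of _ "of_real t"]) auto
  qed
  then have "fps_conv_radius (Abs_fps a) > 0"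
    using assms(1) by (auto simp: fps_conv_radius_def intro: less_le_trans[of _ "ereal \<delta>"])
  moreover have "\<forall>\<^sub>F z in nhds 0. eval_fps (Abs_fps a) z = eval_fps 0 z"
    using eventually_nhds_ball[OF assms(1), of 0] 
  proof eventually_elim
    case (elim z)
    then show ?case using assms(2)[of z] by (simp add: eval_fps_def sums_iff)
  qed
  ultimately have "Abs_fps a = 0" by (intro eval_fps_eqD) auto
  then show ?thesis by (metis fps_nth_Abs_fps fps_zero_nth)
qed

section \<open>The moment problem\<close>

abbreviation control_measure :: "complex set \<Rightarrow> real \<Rightarrow> (real \<times> complex) measure" where
  "control_measure \<omega> T \<equiv> restrict_space lborel {0..T} \<Otimes>\<^sub>M restrict_space circle_measure \<omega>"

lemma finite_measure_restrict_Icc: "finite_measure (restrict_space lborel {0..T :: real})"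
  by (rule finite_measureI)
     (auto simp: emeasure_restrict_space space_restrict_space emeasure_lborel_Icc_eq)

lemma finite_measure_restrict_circle:
  "\<omega> \<in> sets borel \<Longrightarrow> finite_measure (restrict_space circle_measure \<omega>)"
  by (rule finite_measureI) (auto simp: emeasure_restrict_space space_restrict_space)

lemma control_measure_fst_snd_borel:
  "fst \<in> borel_measurable (control_measure \<omega> T)" "snd \<in> borel_measurable (control_measure \<omega> T)"
proof -
  have "(\<lambda>s. s) \<in> borel_measurable (restrict_space lborel {0..T})"
    "(\<lambda>z. z) \<in> borel_measurable (restrict_space circle_measure \<omega>)"
    by (rule measurable_restrict_space1; simp)+
  then show "fst \<in> borel_measurable (control_measure \<omega> T)" "snd \<in> borel_measurable (control_measure \<omega> T)"
    by (auto intro: measurable_compose[OF measurable_fst] measurable_compose[OF measurable_snd])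
qed

lemma space_control_measure: "space (control_measure \<omega> T) = {0..T} \<times> \<omega>"
  by (simp add: space_pair_measure space_restrict_space)

text \<open>The measure is finite, so the constant 1 is square integrable and \<open>u\<close> is a
  product of two square integrable functions.\<close>

lemma is_control_integrable:
  assumes "\<omega> \<in> sets borel" "is_control \<omega> T u"
  shows "integrable (control_measure \<omega> T) u"
proof -
  interpret finite_measure "control_measure \<omega> T"
    using assms(1) by (intro finite_measure_pair_measure finite_measure_restrict_Icc finite_measure_restrict_circle)
  have "square_integrable (control_measure \<omega> T) (\<lambda>_. 1)"
    by (simp add: square_integrable_def)
  from integrable_mult_square_integrable[OF assms(2)[unfolded is_control_def] this] show ?thesis by simp
qed

text \<open>The extension by 0 is square integrable on the circle, so \<open>L2T_of\<close> returns
  its class and not the default value 0.\<close>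

lemma fourier_coeff_L2T_of_restrict:
  assumes \<omega>: "\<omega> \<in> sets borel" and u: "square_integrable (restrict_space circle_measure \<omega>) v"
  shows "fourier_coeff (L2T_of (\<lambda>z. if z \<in> \<omega> then v z else 0)) n =
    (LINT z|restrict_space circle_measure \<omega>. v z * z powi (- n))"
proof -
  have \<omega>': "\<omega> \<inter> space circle_measure \<in> sets circle_measure" using \<omega> by simp
  have ind: "(\<lambda>z. if z \<in> \<omega> then v z else 0) = (\<lambda>z. indicator \<omega> z *\<^sub>R v z)"
    by (auto simp: indicator_def)
  have "square_integrable circle_measure (\<lambda>z. if z \<in> \<omega> then v z else 0)"
    unfolding square_integrable_def
  proof
    show "(\<lambda>z. if z \<in> \<omega> then v z else 0) \<in> borel_measurable circle_measure"
      using u unfolding ind square_integrable_def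
      by (simp add: borel_measurable_restrict_space_iff[OF \<omega>'])
    have "integrable circle_measure (\<lambda>z. indicator \<omega> z *\<^sub>R (cmod (v z))\<^sup>2)"
      using u unfolding square_integrable_def by (simp add: integrable_restrict_space[OF \<omega>'])
    also have "(\<lambda>z. indicator \<omega> z *\<^sub>R (cmod (v z))\<^sup>2) = (\<lambda>z. (cmod (if z \<in> \<omega> then v z else 0))\<^sup>2)"
      by (auto simp: indicator_def)
    finally show "integrable circle_measure (\<lambda>z. (cmod (if z \<in> \<omega> then v z else 0))\<^sup>2)" .
  qed
  then have "fourier_coeff (L2T_of (\<lambda>z. if z \<in> \<omega> then v z else 0)) n =
      (LINT z|circle_measure. (if z \<in> \<omega> then v z else 0) * z powi (- n))"
    by (simp add: L2T_of_def fourier_coeff_abs_L2T)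
  also have "\<dots> = (LINT z|circle_measure. indicator \<omega> z *\<^sub>R (v z * z powi (- n)))"
    by (intro Bochner_Integration.integral_cong) (auto simp: indicator_def)
  also have "\<dots> = (LINT z|restrict_space circle_measure \<omega>. v z * z powi (- n))"
    by (rule integral_restrict_space[OF \<omega>', symmetric])
  finally show ?thesis .
qed

text \<open>The coefficient passes through the Bochner integral. At time \<open>s\<close> the
  semigroup contributes \<open>exp (- real n * (T - s))\<close>; the part depending on
  \<open>s\<close> combines with \<open>z powi (- n)\<close> into the \<open>n\<close>-th power of
  the reciprocal of \<open>exp (- s) * z\<close>. Fubini then joins the two integrals.\<close>

lemma fourier_coeff_Duhamel_integral:
  assumes \<omega>: "\<omega> \<in> sets borel" "\<omega> \<subseteq> sphere 0 1" and u: "is_control \<omega> T u"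
    and int: "set_integrable lborel {0..T}
      (\<lambda>s. semigroup_S (T - s) (riesz_projector (L2T_of (\<lambda>z. if z \<in> \<omega> then u (s, z) else 0))))"
      (is "set_integrable _ _ ?X")
  shows "fourier_coeff (LINT s:{0..T}|lborel. ?X s) (int n) =
    of_real (exp (- real n * T)) *
      (LINT x|control_measure \<omega> T. u x / (of_real (exp (- fst x)) * snd x) ^ n)"
proof -
  let ?L = "restrict_space lborel {0..T}" and ?\<Omega> = "restrict_space circle_measure \<omega>"
  let ?k = "\<lambda>x. u x / (of_real (exp (- fst x)) * snd x) ^ n"
  interpret L: finite_measure ?L by (rule finite_measure_restrict_Icc)
  interpret \<Omega>: finite_measure ?\<Omega> using \<omega>(1) by (rule finite_measure_restrict_circle)
  interpret pair_sigma_finite ?L ?\<Omega> ..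
  note [measurable] = control_measure_fst_snd_borel
  have um [measurable]: "u \<in> borel_measurable (control_measure \<omega> T)"
    using u by (simp add: is_control_def square_integrable_def)
  \<comment> \<open>On the domain of integration the denominator has modulus
    \<open>exp (- n * s)\<close>, at least \<open>exp (- n * T)\<close>, so the kernel is dominated
    by a multiple of \<open>u\<close>.\<close>
  have kint: "integrable (control_measure \<omega> T) ?k"
  proof (rule Bochner_Integration.integrable_bound)
    show "integrable (control_measure \<omega> T) (\<lambda>x. u x * of_real (exp (real n * T)))"
      using is_control_integrable[OF \<omega>(1) u] by simp
    show "AE x in control_measure \<omega> T. norm (?k x) \<le> norm (u x * of_real (exp (real n * T)))"
    proof (rule AE_I2)
      fix x assume "x \<in> space (control_measure \<omega> T)"
      then have x: "fst x \<le> T" "cmod (snd x) = 1"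
        using \<omega>(2) by (auto simp: space_control_measure)
      have "norm (?k x) = cmod (u x) / exp (- fst x) ^ n"
        using x by (simp add: norm_divide norm_mult norm_power)
      also have "\<dots> = cmod (u x) * exp (real n * fst x)"
        by (simp add: exp_minus exp_of_nat_mult power_inverse divide_inverse)
      also have "\<dots> \<le> norm (u x * of_real (exp (real n * T)))"
        using x by (auto simp: norm_mult intro!: mult_left_mono)
      finally show "norm (?k x) \<le> norm (u x * of_real (exp (real n * T)))" .
    qed
  qed measurable
  have X: "integrable ?L ?X"
    using int by (simp add: integrable_restrict_space set_integrable_def)
  have "(LINT s:{0..T}|lborel. ?X s) = (LINT s|?L. ?X s)"
    by (simp add: set_lebesgue_integral_def integral_restrict_space)
  then have "fourier_coeff (LINT s:{0..T}|lborel. ?X s) (int n) = (LINT s|?L. fourier_coeff (?X s) (int n))"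
    using integral_bounded_linear[OF bounded_linear_fourier_coeff X] by simp
  also have "\<dots> = (LINT s|?L. of_real (exp (- real n * T)) * (LINT z|?\<Omega>. ?k (s, z)))"
  proof (rule integral_cong_AE)
    show "(\<lambda>s. fourier_coeff (?X s) (int n)) \<in> borel_measurable ?L"
      using integrable_bounded_linear[OF bounded_linear_fourier_coeff X] by (rule borel_measurable_integrable)
    show "(\<lambda>s. of_real (exp (- real n * T)) * (LINT z|?\<Omega>. ?k (s, z))) \<in> borel_measurable ?L"
      using integrable_fst'[OF kint] by measurable
    \<comment> \<open>Fubini gives square integrable slices \<open>u (s, \<cdot>)\<close> for almost
      every \<open>s\<close> only; at the remaining times \<open>L2T_of\<close> may take its default
      value.\<close>
    have "AE s in ?L. integrable ?\<Omega> (\<lambda>z. (cmod (u (s, z)))\<^sup>2)"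
      using u by (intro AE_integrable_fst') (simp add: is_control_def square_integrable_def)
    then show "AE s in ?L. fourier_coeff (?X s) (int n) = of_real (exp (- real n * T)) * (LINT z|?\<Omega>. ?k (s, z))"
      using AE_space
    proof eventually_elim
      case (elim s)
      then have s: "0 \<le> s" "s \<le> T" by (auto simp: space_restrict_space)
      have "(\<lambda>z. u (s, z)) \<in> borel_measurable ?\<Omega>"
        using measurable_Pair2[OF um] elim by simp
      then have sq: "square_integrable ?\<Omega> (\<lambda>z. u (s, z))"
        using elim by (simp add: square_integrable_def)
      have "fourier_coeff (?X s) (int n) =
          of_real (exp (- real n * (T - s))) * (LINT z|?\<Omega>. u (s, z) * z powi (- int n))"
        using s by (simp add: fourier_coeff_semigroup_S fourier_coeff_riesz_projector
            fourier_coeff_L2T_of_restrict[OF \<omega>(1) sq] mult.commute)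
      also have "\<dots> = of_real (exp (- real n * T)) *
          (LINT z|?\<Omega>. of_real (exp (real n * s)) * (u (s, z) * z powi (- int n)))"
      proof -
        have "exp (- real n * (T - s)) = exp (- real n * T) * exp (real n * s)"
          by (simp add: algebra_simps flip: exp_add)
        then show ?thesis by (simp add: mult.assoc)
      qed
      also have "(\<lambda>z. of_real (exp (real n * s)) * (u (s, z) * z powi (- int n))) = (\<lambda>z. ?k (s, z))"
        unfolding exp_of_nat_mult of_real_power
        by (auto simp: exp_minus power_int_minus power_mult_distrib power_inverse field_simps)
      finally show ?case .
    qed
  qed
  also have "\<dots> = of_real (exp (- real n * T)) * (LINT x|control_measure \<omega> T. ?k x)"
    using integral_fst'[OF kint] by simp
  finally show ?thesis .
qed

text \<open>Take the \<open>n\<close>-th coefficient of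
  \<open>final_state \<omega> T f u = 0\<close> and cancel the common factor
  \<open>exp (- n * T)\<close>. This gives the moments with density \<open>v = - u\<close>.\<close>

lemma NC_H2_moments:
  assumes \<omega>: "\<omega> \<in> sets borel" "\<omega> \<subseteq> sphere 0 1" and T: "T > 0" and f: "f \<in> NC_H2 \<omega> T"
  obtains v where "integrable (control_measure \<omega> T) v"
    "\<And>n. fourier_coeff f (int n) =
       (LINT x|control_measure \<omega> T. v x / (of_real (exp (- fst x)) * snd x) ^ n)"
proof -
  obtain u where u: "is_control \<omega> T u" and fin: "final_state \<omega> T f u = 0"
    using f by (auto simp: NC_H2_def)
  let ?X = "\<lambda>s. semigroup_S (T - s) (riesz_projector (L2T_of (\<lambda>z. if z \<in> \<omega> then u (s, z) else 0)))"
  let ?I = "LINT s:{0..T}|lborel. ?X s"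
  have "?I = - semigroup_S T f"
    using fin unfolding final_state_def by (simp add: eq_neg_iff_add_eq_0 add.commute)
  then have I: "fourier_coeff ?I n = - fourier_coeff (semigroup_S T f) n" for n
    by (simp add: linear_neg[OF bounded_linear.linear[OF bounded_linear_fourier_coeff]])
  have coeff: "of_real (exp (- real n * T)) * fourier_coeff f (int n) = - fourier_coeff ?I (int n)" for n
    using T by (simp add: I fourier_coeff_semigroup_S mult.commute)
  \<comment> \<open>The Bochner integral of a function that is not integrable is \<open>0\<close>, hence the case distinction.\<close>
  show ?thesis
  proof (cases "set_integrable lborel {0..T} ?X")
    case True
    have "fourier_coeff f (int n) =
        (LINT x|control_measure \<omega> T. - u x / (of_real (exp (- fst x)) * snd x) ^ n)" for n
    proof -
      have "of_real (exp (- real n * T)) * fourier_coeff f (int n) = of_real (exp (- real n * T)) *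
          - (LINT x|control_measure \<omega> T. u x / (of_real (exp (- fst x)) * snd x) ^ n)"
        using coeff[of n] unfolding fourier_coeff_Duhamel_integral[OF \<omega> u True] mult_minus_right .
      then have "fourier_coeff f (int n) =
          - (LINT x|control_measure \<omega> T. u x / (of_real (exp (- fst x)) * snd x) ^ n)"
        by (subst (asm) mult_cancel_left) simp
      then show ?thesis by simp
    qed
    then show ?thesis
      using is_control_integrable[OF \<omega>(1) u] by (intro that[of "\<lambda>x. - u x"]) auto
  next
    case False
    then have "?I = 0"
      by (simp add: set_integrable_def set_lebesgue_integral_def not_integrable_integral_eq)
    then have "fourier_coeff f (int n) = 0" for n
      using coeff[of n] linear_0[OF bounded_linear.linear[OF bounded_linear_fourier_coeff]] by simp
    \<comment> \<open>All coefficients of nonnegative index vanish here, so the zero density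
      represents them.\<close>
    then show ?thesis by (intro that[of "\<lambda>x. 0"]) auto
  qed
qed

theorem corollary1p6:
  fixes \<omega> :: "complex set" and T :: real and f\<^sub>0 :: L2T
  assumes "openin (top_of_set (sphere 0 1)) \<omega>" and "closure \<omega> \<noteq> sphere 0 1"
    and "T > 0"
    and "f\<^sub>0 \<in> H2" and "extends_to_larger_disk f\<^sub>0"
    and "f\<^sub>0 \<in> NC_H2 \<omega> T"
  shows "f\<^sub>0 = 0"
proof (rule H2_eq_0I[OF \<open>f\<^sub>0 \<in> H2\<close>])
  let ?M = "control_measure \<omega> T" and ?p = "\<lambda>x. of_real (exp (- fst x)) * snd x"
  have \<omega>: "\<omega> \<subseteq> sphere 0 1" using assms(1) openin_imp_subset by blast
  obtain U where "open U" "\<omega> = sphere 0 1 \<inter> U" using assms(1) unfolding openin_open by blast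
  then have borel: "\<omega> \<in> sets borel" by (auto intro!: borel_closed borel_open sets.Int)
  \<comment> \<open>Passing to the closure makes the sector compact; it still misses a point of the
    circle by assumption, which supplies the ray.\<close>
  have closure: "compact (closure \<omega>)" "closure \<omega> \<subseteq> sphere 0 1"
    using \<omega> bounded_subset[OF bounded_sphere] closed_sphere by (auto simp: closure_minimal compact_closure)
  obtain v where v: "integrable ?M v" and moments: "\<And>n. fourier_coeff f\<^sub>0 (int n) = (LINT x|?M. v x / ?p x ^ n)"
    using NC_H2_moments[OF borel \<omega> assms(3,6)] by blast
  obtain r F where r: "r > 1" and F: "F holomorphic_on ball 0 r"
    and F_eq: "\<And>z. z \<in> ball 0 1 \<Longrightarrow> F z = disk_function f\<^sub>0 z"
    using assms(5) unfolding extends_to_larger_disk_def by blast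
  \<comment> \<open>The smallest value of \<open>exp (- s)\<close> for \<open>s\<close> in
    \<open>{0..T}\<close>, hence the inner radius of the sector.\<close>
  define \<delta> where "\<delta> = exp (- T)"
  have \<delta>: "0 < \<delta>" "\<delta> < 1" using assms(3) by (auto simp: \<delta>_def)
  let ?C = "annular_sector \<delta> (closure \<omega>)"
  note [measurable] = control_measure_fst_snd_borel
  have p [measurable]: "?p \<in> borel_measurable ?M" by measurable
  have p_in: "?p x \<in> ?C" if x: "x \<in> space ?M" for x
  proof -
    have "exp (- fst x) \<in> {\<delta>..1}" "snd x \<in> closure \<omega>"
      using x closure_subset[of \<omega>] by (auto simp: space_control_measure \<delta>_def)
    then show ?thesis unfolding annular_sector_def by (intro image_eqI[of _ _ "(exp (- fst x), snd x)"]) auto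
  qed
  have p_norm: "\<delta> \<le> cmod (?p x)" "cmod (?p x) \<le> 1" if "x \<in> space ?M" for x
    using cmod_annular_sector[OF p_in[OF that] closure(2) \<delta>(1)] by auto
  have vp: "integrable ?M (\<lambda>x. v x * ?p x)"
  proof (rule Bochner_Integration.integrable_bound[OF v])
    show "AE x in ?M. norm (v x * ?p x) \<le> norm (v x)"
      using p_norm(2) by (intro AE_I2) (auto simp: norm_mult[of "v _"] mult_left_le)
  qed (use v in measurable)
  \<comment> \<open>The density is \<open>v\<close> times \<open>?p\<close>, so that the Taylor
    coefficients of \<open>g\<close> at 0 are the moments of \<open>v\<close>, that is, the
    coefficients of \<open>f\<^sub>0\<close>.\<close>
  define g where "g \<zeta> = (LINT x|?M. v x * ?p x / (?p x - \<zeta>))" for \<zeta>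
  have "g holomorphic_on - ?C"
    unfolding g_def using compact_annular_sector[OF closure(1)] p_in
    by (intro cauchy_transform_holomorphic[OF vp p]) (auto intro: compact_imp_closed)
  moreover have "(g \<longlongrightarrow> 0) at_infinity"
    unfolding g_def by (rule cauchy_transform_tendsto_0[OF vp p p_norm(2)])
  \<comment> \<open>The geometric expansion holds below the inner radius \<open>\<delta>\<close>,
    and \<open>\<delta> < 1\<close> puts these points in the unit disk, where \<open>F\<close> is
    \<open>disk_function f\<^sub>0\<close>.\<close>
  moreover have "F z = g z" if z: "cmod z < \<delta>" for z
  proof -
    have "(\<lambda>n. fourier_coeff f\<^sub>0 (int n) * z ^ n) sums g z"
      unfolding moments g_def by (rule cauchy_transform_sums[OF v p p_norm(1) z])
    then show ?thesis using F_eq[of z] z \<delta> by (simp add: disk_function_def sums_iff)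
  qed
  ultimately have F_0: "F z = 0" if "cmod z < r" for z
    using eq_0_if_continues_off_annular_sector[OF F r _ _ closure assms(2) \<delta>(1)] that by blast
  show "fourier_coeff f\<^sub>0 (int n) = 0" for n
  proof (rule powser_eq_0_imp_coeffs_eq_0[of 1])
    fix z :: complex assume z: "cmod z < 1"
    then have "disk_function f\<^sub>0 z = 0" using F_eq[of z] F_0[of z] r by simp
    then show "(\<lambda>n. fourier_coeff f\<^sub>0 (int n) * z ^ n) sums 0"
      using summable_fourier_coeff_power[OF z, of f\<^sub>0] unfolding disk_function_def
      by (metis summable_sums)
  qed simp
qed

end
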